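(* Let $\mathcal{G}=(B,\psi,A)$ be a $d$-regular undirected tracial quantum graph. The following are equivalent: (1) $\mathcal{G}$ has a bipartite component; (2) $-d\in\mathrm{spec}(A)$, where if $d=0$ it is additionally required that the multiplicity of $0\in\mathrm{spec}(A)$ is at least two, i.e. $\dim B\ge 2$.
   Context: A quantum set is a pair $(B,\psi)$ where $B$ is a finite-dimensional $C^*$-algebra with multiplication $m:B\otimes B\to B$, and $\psi$ is a faithful state on $B$ that is a $\delta$-form, i.e. $mm^\dagger=\delta^2\,\mathrm{id}_B$ for some $\delta\ge 0$. Here $B$ is regarded as the Hilbert space $L^2(B,\psi)$ with inner product $\langle x|y\rangle=\psi(x^*y)$, $B\otimes B$ carries the inner product from $\psi\otimes\psi$, and $(\cdot)^\dagger$ is the Hilbert space adjoint of operators. For linear maps $S,T:B\to B$, the Schur product is $S\bullet T=\delta^{-2}m(S\otimes T)m^\dagger$ and the involution is $T^*(x)=(T(x^* ))^*$. A quantum graph is a triple $(B,\psi,A)$ with $(B,\psi)$ a quantum set and $A:B\to B$ linear satisfying $A\bullet A=A$. It is real if $A^*=A$; undirected if $A$ is real and $A=A^\dagger$; tracial if $\psi$ is a trace; $d$-regular ($d\in\mathbb{C}$) if $A1_B=d1_B=A^\dagger 1_B$. $\mathcal{G}$ has a bipartite component if there is a graph homomorphism $\mathcal{G}\to K_2\sqcup T_1$ that is onto $K_2$, i.e. there is a unital $*$-homomorphism $f:\mathbb{C}^2\oplus\mathbb{C}\to B$ that is injective on $\mathbb{C}^2\oplus 0$ and satisfies \[ \begin{pmatrix}0&1&0\\1&0&0\\0&0&1\end{pmatrix}\bullet(f^\dagger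 Af)=f^\dagger Af, \] where $\mathbb{C}^2\oplus\mathbb{C}=\mathbb{C}^3$ carries the tracial state $\tau(a,b,c)=(a+b+c)/3$, $f^\dagger$ is the adjoint of $f:L^2(\mathbb{C}^3,\tau)\to L^2(B,\psi)$, and $\bullet$ is the Schur product on $(\mathbb{C}^3,\tau)$ (the entrywise product of $3\times3$ matrices). *)

theory Defs
  imports "HOL-Analysis.Analysis"
begin

section \<open>Complex vector spaces and star-algebras\<close>

class scaleC =
  fixes scaleC :: "complex \<Rightarrow> 'a \<Rightarrow> 'a"  (infixr "*\<^sub>C" 75)

class complex_vector = scaleC + ab_group_add +
  assumes scaleC_add_right: "c *\<^sub>C (x + y) = c *\<^sub>C x + c *\<^sub>C y"
    and scaleC_add_left: "(c + d) *\<^sub>C x = c *\<^sub>C x + d *\<^sub>C x"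
    and scaleC_scaleC: "c *\<^sub>C (d *\<^sub>C x) = (c * d) *\<^sub>C x"
    and scaleC_one: "1 *\<^sub>C x = x"

global_interpretation complex_vector:
  vector_space "scaleC :: complex \<Rightarrow> 'a \<Rightarrow> 'a::complex_vector"
  by unfold_locales (simp_all add: scaleC_add_right scaleC_add_left scaleC_scaleC scaleC_one)

global_interpretation complex_vector:
  vector_space_pair "scaleC :: complex \<Rightarrow> 'a \<Rightarrow> 'a::complex_vector"
    "scaleC :: complex \<Rightarrow> 'b \<Rightarrow> 'b::complex_vector"
  by unfold_locales

abbreviation clinear :: "('a::complex_vector \<Rightarrow> 'b::complex_vector) \<Rightarrow> bool" where
  "clinear \<equiv> Vector_Spaces.linear scaleC scaleC"

lemma clinearI:
  assumes "\<And>x y. f (x + y) = f x + f y" and "\<And>c x. f (c *\<^sub>C x) = c *\<^sub>C f x"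
  shows "clinear f"
  using assms by unfold_locales auto

lemmas clinear_add = complex_vector.linear_add
lemmas clinear_scale = complex_vector.linear_scale
lemmas clinear_0 = complex_vector.linear_0

class star_algebra = complex_vector + ring_1 +
  fixes star :: "'a \<Rightarrow> 'a"
  assumes scaleC_mult_left: "(c *\<^sub>C x) * y = c *\<^sub>C (x * y)"
    and scaleC_mult_right: "x * (c *\<^sub>C y) = c *\<^sub>C (x * y)"
    and star_add: "star (x + y) = star x + star y"
    and star_scaleC: "star (c *\<^sub>C x) = cnj c *\<^sub>C star x"
    and star_mult: "star (x * y) = star y * star x"
    and star_star: "star (star x) = x"

text \<open>Since \<open>real_normed_algebra_1\<close> includes \<open>0 \<noteq> 1\<close>, the zero algebra is excluded; it
  carries no state.\<close>

class cstar_algebra = star_algebra + real_normed_algebra_1 + complete_space +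
  assumes scaleR_scaleC: "r *\<^sub>R x = complex_of_real r *\<^sub>C x"
    and norm_scaleC: "norm (c *\<^sub>C x) = cmod c * norm x"
    and cstar_identity: "norm (star x * x) = (norm x)\<^sup>2"

class fd_cstar_algebra = cstar_algebra +
  assumes finite_dimensional: "\<exists>S. finite S \<and> (\<forall>x. \<exists>c. x = (\<Sum>v\<in>S. c v *\<^sub>C v))"

instantiation complex :: star_algebra
begin
definition scaleC_complex :: "complex \<Rightarrow> complex \<Rightarrow> complex" where
  "scaleC_complex c x = c * x"
definition star_complex :: "complex \<Rightarrow> complex" where
  "star_complex x = cnj x"
instance
  by standard (simp_all add: scaleC_complex_def star_complex_def algebra_simps)
end

instance complex :: cstar_algebra
  by standard (simp_all add: scaleC_complex_def star_complex_def scaleR_conv_of_real norm_mult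
      power2_eq_square)

instance complex :: fd_cstar_algebra
proof
  have "x = (\<Sum>v\<in>{1}. x *\<^sub>C v)" for x :: complex
    by (simp add: scaleC_complex_def)
  then have "\<forall>x :: complex. \<exists>c. x = (\<Sum>v\<in>{1}. c v *\<^sub>C v)"
    by (intro allI, rule_tac x = "\<lambda>_. x" in exI)
  then show "\<exists>S. finite S \<and> (\<forall>x :: complex. \<exists>c. x = (\<Sum>v\<in>S. c v *\<^sub>C v))"
    by (intro exI[of _ "{1}"] conjI finite.intros)
qed

text \<open>With the library's entrywise operations on vectors, \<open>complex ^ 'n\<close> is the commutative
  star-algebra of functions on \<open>'n\<close>. Its library norm is Euclidean, hence not the C*-norm; no norm
  is used for it below.\<close>

instantiation vec :: (complex_vector, finite) complex_vector
begin
definition scaleC_vec :: "complex \<Rightarrow> 'a ^ 'b \<Rightarrow> 'a ^ 'b" where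
  "scaleC_vec c x = (\<chi> i. c *\<^sub>C (x $ i))"
instance
  by standard (simp_all add: scaleC_vec_def vec_eq_iff scaleC_add_right scaleC_add_left
      scaleC_scaleC scaleC_one)
end

instantiation vec :: (star_algebra, finite) star_algebra
begin
definition star_vec :: "'a ^ 'b \<Rightarrow> 'a ^ 'b" where
  "star_vec x = (\<chi> i. star (x $ i))"
instance
  by standard (simp_all add: scaleC_vec_def star_vec_def vec_eq_iff scaleC_mult_left
      scaleC_mult_right star_add star_scaleC star_mult star_star)
end


section \<open>Algebraic tensor products\<close>

definition cbilinear :: "('a::complex_vector \<Rightarrow> 'b::complex_vector \<Rightarrow> 'c::complex_vector) \<Rightarrow> bool" where
  "cbilinear \<beta> \<longleftrightarrow> (\<forall>y. clinear (\<lambda>x. \<beta> x y)) \<and> (\<forall>x. clinear (\<beta> x))"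

definition formal_sum :: "('a \<Rightarrow> 'b \<Rightarrow> 'c::comm_monoid_add) \<Rightarrow> ('a \<times> 'b) list \<Rightarrow> 'c" where
  "formal_sum \<beta> l = (\<Sum>(x, y)\<leftarrow>l. \<beta> x y)"

lemma formal_sum_simps [simp]:
  "formal_sum \<beta> [] = 0"
  "formal_sum \<beta> (p # l) = \<beta> (fst p) (snd p) + formal_sum \<beta> l"
  "formal_sum \<beta> (l @ l') = formal_sum \<beta> l + formal_sum \<beta> l'"
  by (auto simp: formal_sum_def case_prod_beta)

text \<open>A list of pairs \<open>(x\<^sub>i, y\<^sub>i)\<close> stands for the tensor \<open>\<Sum>\<^sub>i x\<^sub>i \<otimes> y\<^sub>i\<close>; two lists stand for the
  same tensor iff no bilinear form separates them.\<close>

definition tensor_eq ::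
  "('a::complex_vector \<times> 'b::complex_vector) list \<Rightarrow> ('a \<times> 'b) list \<Rightarrow> bool" where
  "tensor_eq l l' \<longleftrightarrow> (\<forall>\<beta> :: 'a \<Rightarrow> 'b \<Rightarrow> complex. cbilinear \<beta> \<longrightarrow> formal_sum \<beta> l = formal_sum \<beta> l')"

quotient_type (overloaded) ('a, 'b) tensor =
  "('a::complex_vector \<times> 'b::complex_vector) list" / tensor_eq
  by (rule equivpI) (auto simp: reflp_def symp_def transp_def tensor_eq_def)

lift_definition tensor_of :: "'a::complex_vector \<Rightarrow> 'b::complex_vector \<Rightarrow> ('a, 'b) tensor"
    (infixl "\<otimes>" 71)
  is "\<lambda>x y. [(x, y)]" .

lemma cbilinear_add:
  assumes "cbilinear \<beta>"
  shows "\<beta> (x + x') y = \<beta> x y + \<beta> x' y" "\<beta> x (y + y') = \<beta> x y + \<beta> x y'"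
    "\<beta> (c *\<^sub>C x) y = c *\<^sub>C \<beta> x y" "\<beta> x (c *\<^sub>C y) = c *\<^sub>C \<beta> x y"
  using assms unfolding cbilinear_def
  by (metis clinear_add clinear_scale)+

lemma cbilinearI:
  assumes "\<And>x x' y. \<beta> (x + x') y = \<beta> x y + \<beta> x' y" "\<And>x y y'. \<beta> x (y + y') = \<beta> x y + \<beta> x y'"
    "\<And>c x y. \<beta> (c *\<^sub>C x) y = c *\<^sub>C \<beta> x y" "\<And>c x y. \<beta> x (c *\<^sub>C y) = c *\<^sub>C \<beta> x y"
  shows "cbilinear \<beta>"
  using assms by (auto simp: cbilinear_def intro!: clinearI)

lemma formal_sum_scale:
  assumes "cbilinear \<beta>"
  shows "formal_sum \<beta> (map (\<lambda>(x, y). (c *\<^sub>C x, y)) l) = c *\<^sub>C formal_sum \<beta> l"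
  by (induction l) (auto simp: cbilinear_add[OF assms] scaleC_add_right)

instantiation tensor :: (complex_vector, complex_vector) complex_vector
begin

lift_definition zero_tensor :: "('a, 'b) tensor" is "[]" .

lift_definition plus_tensor :: "('a, 'b) tensor \<Rightarrow> ('a, 'b) tensor \<Rightarrow> ('a, 'b) tensor"
  is "(@)" by (auto simp: tensor_eq_def)

lift_definition scaleC_tensor :: "complex \<Rightarrow> ('a, 'b) tensor \<Rightarrow> ('a, 'b) tensor"
  is "\<lambda>c. map (\<lambda>(x, y). (c *\<^sub>C x, y))" by (auto simp: tensor_eq_def formal_sum_scale)

definition uminus_tensor :: "('a, 'b) tensor \<Rightarrow> ('a, 'b) tensor" where
  "uminus_tensor t = (-1) *\<^sub>C t"

definition minus_tensor :: "('a, 'b) tensor \<Rightarrow> ('a, 'b) tensor \<Rightarrow> ('a, 'b) tensor" where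
  "minus_tensor s t = s + - t"

instance
proof
  fix a b c :: "('a, 'b) tensor" and z w :: complex
  show "a + b + c = a + (b + c)"
    by transfer (simp add: tensor_eq_def)
  show "a + b = b + a"
    by transfer (simp add: tensor_eq_def)
  show "0 + a = a"
    by transfer (simp add: tensor_eq_def)
  show "- a + a = 0"
    unfolding uminus_tensor_def
  proof (transfer, unfold tensor_eq_def, intro allI impI)
    fix l :: "('a \<times> 'b) list" and \<beta> :: "'a \<Rightarrow> 'b \<Rightarrow> complex"
    assume "cbilinear \<beta>"
    from formal_sum_scale[OF this, of "-1" l]
    show "formal_sum \<beta> (map (\<lambda>(x, y). ((-1) *\<^sub>C x, y)) l @ l) = formal_sum \<beta> []"
      by (simp add: scaleC_complex_def)
  qed
  show "a - b = a + - b"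
    by (simp add: minus_tensor_def)
  show "z *\<^sub>C (a + b) = z *\<^sub>C a + z *\<^sub>C b"
    by transfer (simp add: tensor_eq_def)
  show "(z + w) *\<^sub>C a = z *\<^sub>C a + w *\<^sub>C a"
    by transfer (auto simp: tensor_eq_def formal_sum_scale scaleC_add_left[symmetric])
  show "z *\<^sub>C (w *\<^sub>C a) = (z * w) *\<^sub>C a"
    by transfer (auto simp: tensor_eq_def formal_sum_scale scaleC_scaleC simp del: map_map)
  show "1 *\<^sub>C a = a"
    by transfer (auto simp: tensor_eq_def formal_sum_scale scaleC_one)
qed

end

lemma tensor_of_bilinear: "cbilinear (\<otimes>)"
proof (rule cbilinearI)
  fix x x' :: 'a and y y' :: 'b and c :: complex
  show "(x + x') \<otimes> y = x \<otimes> y + x' \<otimes> y"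
    by transfer (simp add: tensor_eq_def cbilinear_add)
  show "x \<otimes> (y + y') = x \<otimes> y + x \<otimes> y'"
    by transfer (simp add: tensor_eq_def cbilinear_add)
  show "(c *\<^sub>C x) \<otimes> y = c *\<^sub>C (x \<otimes> y)"
    by transfer (simp add: tensor_eq_def)
  show "x \<otimes> (c *\<^sub>C y) = c *\<^sub>C (x \<otimes> y)"
    by transfer (simp add: tensor_eq_def cbilinear_add)
qed

lemma tensor_induct [case_names tensor_of add]:
  fixes t :: "('a::complex_vector, 'b::complex_vector) tensor"
  assumes elem: "\<And>x y. P (x \<otimes> y)" and add: "\<And>s t. P s \<Longrightarrow> P t \<Longrightarrow> P (s + t)"
  shows "P t"
proof -
  have "P (abs_tensor l)" for l :: "('a \<times> 'b) list"
  proof (induction l)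
    case Nil
    have "abs_tensor [] = (0 :: 'a) \<otimes> (0 :: 'b)"
      unfolding zero_tensor_def[symmetric]
      using cbilinear_add(3)[OF tensor_of_bilinear, of 0 0 0] by simp
    then show ?case using elem by metis
  next
    case (Cons p l)
    have "abs_tensor (p # l) = fst p \<otimes> snd p + abs_tensor l"
      by (simp add: tensor_of.abs_eq plus_tensor.abs_eq)
    then show ?case using elem add Cons by metis
  qed
  then show ?thesis by (metis Quotient_abs_rep[OF Quotient_tensor])
qed

text \<open>The linear map on the tensor product induced by a bilinear map; the chosen representative
  does not matter, by the universal property shown next.\<close>

definition tensor_lift ::
  "('a::complex_vector \<Rightarrow> 'b::complex_vector \<Rightarrow> 'c::complex_vector) \<Rightarrow> ('a, 'b) tensor \<Rightarrow> 'c" where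
  "tensor_lift \<beta> t = formal_sum \<beta> (rep_tensor t)"

lemma clinear_separates:
  fixes v :: "'a::complex_vector"
  assumes "v \<noteq> 0"
  obtains \<phi> :: "'a \<Rightarrow> complex" where "clinear \<phi>" "\<phi> v = 1"
proof -
  have "complex_vector.independent {v}"
    using assms by (simp add: complex_vector.dependent_single)
  from complex_vector.linear_independent_extend[OF this, of "\<lambda>_. 1 :: complex"]
  show ?thesis using that by auto
qed

lemma formal_sum_well_defined:
  fixes \<beta> :: "'a::complex_vector \<Rightarrow> 'b::complex_vector \<Rightarrow> 'c::complex_vector"
  assumes \<beta>: "cbilinear \<beta>" and eq: "tensor_eq l l'"
  shows "formal_sum \<beta> l = formal_sum \<beta> l'"
proof (rule ccontr)
  assume "\<not> ?thesis"
  then have "formal_sum \<beta> l - formal_sum \<beta> l' \<noteq> 0" by simp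
  then obtain \<phi> :: "'c \<Rightarrow> complex"
    where \<phi>: "clinear \<phi>" "\<phi> (formal_sum \<beta> l - formal_sum \<beta> l') = 1"
    by (rule clinear_separates)
  have comp: "\<phi> (formal_sum \<beta> k) = formal_sum (\<lambda>x y. \<phi> (\<beta> x y)) k" for k
    by (induction k) (simp_all add: clinear_0[OF \<phi>(1)] clinear_add[OF \<phi>(1)])
  have "cbilinear (\<lambda>x y. \<phi> (\<beta> x y))"
    by (rule cbilinearI)
      (simp_all add: cbilinear_add[OF \<beta>] clinear_add[OF \<phi>(1)] clinear_scale[OF \<phi>(1)])
  then have "\<phi> (formal_sum \<beta> l) = \<phi> (formal_sum \<beta> l')"
    using eq by (auto simp: comp tensor_eq_def)
  then show False
    using \<phi> by (simp add: complex_vector.linear_diff)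
qed

lemma tensor_lift_abs:
  assumes "cbilinear \<beta>"
  shows "tensor_lift \<beta> (abs_tensor l) = formal_sum \<beta> l"
  unfolding tensor_lift_def
  by (rule formal_sum_well_defined[OF assms])
    (metis Quotient_abs_rep[OF Quotient_tensor] tensor.abs_eq_iff)

lemma tensor_lift_tensor_of:
  assumes "cbilinear \<beta>"
  shows "tensor_lift \<beta> (x \<otimes> y) = \<beta> x y"
  by (simp add: tensor_of.abs_eq tensor_lift_abs[OF assms])

lemma clinear_tensor_lift:
  assumes "cbilinear \<beta>"
  shows "clinear (tensor_lift \<beta>)"
proof (rule clinearI)
  fix s t :: "('a, 'b) tensor" and c :: complex
  obtain k l where [simp]: "s = abs_tensor k" "t = abs_tensor l"
    by (metis Quotient_abs_rep[OF Quotient_tensor])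
  show "tensor_lift \<beta> (s + t) = tensor_lift \<beta> s + tensor_lift \<beta> t"
    by (simp add: plus_tensor.abs_eq tensor_lift_abs[OF assms])
  show "tensor_lift \<beta> (c *\<^sub>C s) = c *\<^sub>C tensor_lift \<beta> s"
    by (simp add: scaleC_tensor.abs_eq tensor_lift_abs[OF assms] formal_sum_scale[OF assms])
qed

lemmas tensor_lift_simps = tensor_lift_tensor_of
  clinear_add[OF clinear_tensor_lift] clinear_scale[OF clinear_tensor_lift]

lemma cbilinear_star_mult: "cbilinear ((*) :: 'a::star_algebra \<Rightarrow> 'a \<Rightarrow> 'a)"
  by (rule cbilinearI) (simp_all add: algebra_simps scaleC_mult_left scaleC_mult_right)

lemmas tensor_bilin = cbilinear_add[OF tensor_of_bilinear]

text \<open>The product of the tensor product algebra is determined by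
  \<open>(x \<otimes> y) * (x' \<otimes> y') = (x * x') \<otimes> (y * y')\<close>, its involution by
  \<open>star (x \<otimes> y) = star x \<otimes> star y\<close>.\<close>

definition tensor_left_mult ::
  "'a::star_algebra \<Rightarrow> 'b::star_algebra \<Rightarrow> ('a, 'b) tensor \<Rightarrow> ('a, 'b) tensor" where
  "tensor_left_mult x y = tensor_lift (\<lambda>x' y'. (x * x') \<otimes> (y * y'))"

lemma cbilinear_tensor_left_mult_aux:
  "cbilinear (\<lambda>x' y'. ((x::'a::star_algebra) * x') \<otimes> ((y::'b::star_algebra) * y'))"
  by (rule cbilinearI) (simp_all add: distrib_left scaleC_mult_right tensor_bilin)

lemmas tensor_left_mult_simps =
  tensor_lift_simps[OF cbilinear_tensor_left_mult_aux, folded tensor_left_mult_def]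

lemma cbilinear_tensor_left_mult: "cbilinear (\<lambda>x y. tensor_left_mult x y t)"
proof (induction t rule: tensor_induct)
  case (tensor_of x y)
  show ?case
    by (rule cbilinearI)
      (simp_all add: tensor_left_mult_simps distrib_right scaleC_mult_left tensor_bilin)
next
  case (add s t)
  show ?case
    by (rule cbilinearI)
      (simp_all add: tensor_left_mult_simps cbilinear_add[OF add(1)] cbilinear_add[OF add(2)]
        scaleC_add_right)
qed

instantiation tensor :: (star_algebra, star_algebra) star_algebra
begin

definition one_tensor :: "('a, 'b) tensor" where
  "one_tensor = 1 \<otimes> 1"

definition times_tensor :: "('a, 'b) tensor \<Rightarrow> ('a, 'b) tensor \<Rightarrow> ('a, 'b) tensor" where
  "times_tensor s t = tensor_lift (\<lambda>x y. tensor_left_mult x y t) s"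

lift_definition star_tensor :: "('a, 'b) tensor \<Rightarrow> ('a, 'b) tensor"
  is "map (\<lambda>(x, y). (star x, star y))"
proof (unfold tensor_eq_def, intro allI impI)
  fix l l' :: "('a \<times> 'b) list" and \<beta> :: "'a \<Rightarrow> 'b \<Rightarrow> complex"
  assume eq: "\<forall>\<beta> :: 'a \<Rightarrow> 'b \<Rightarrow> complex. cbilinear \<beta> \<longrightarrow> formal_sum \<beta> l = formal_sum \<beta> l'"
    and \<beta>: "cbilinear \<beta>"
  let ?\<gamma> = "\<lambda>x y. cnj (\<beta> (star x) (star y))"
  have \<gamma>: "cbilinear ?\<gamma>"
    by (rule cbilinearI)
      (simp_all add: star_add star_scaleC cbilinear_add[OF \<beta>] scaleC_complex_def)
  have "formal_sum \<beta> (map (\<lambda>(x, y). (star x, star y)) k) = cnj (formal_sum ?\<gamma> k)" for k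
    by (induction k) auto
  then show "formal_sum \<beta> (map (\<lambda>(x, y). (star x, star y)) l) =
      formal_sum \<beta> (map (\<lambda>(x, y). (star x, star y)) l')"
    using eq \<gamma> by metis
qed

instance
proof
  have mult_elem: "(x \<otimes> y) * t = tensor_left_mult x y t" for x y and t :: "('a, 'b) tensor"
    by (simp add: times_tensor_def tensor_lift_simps[OF cbilinear_tensor_left_mult])
  have mult_elems: "(x \<otimes> y) * (x' \<otimes> y') = (x * x') \<otimes> (y * y')"
    for x x' :: 'a and y y' :: 'b
    by (simp add: mult_elem tensor_left_mult_simps)
  have distr: "(a + b) * c = a * c + b * c" for a b c :: "('a, 'b) tensor"
    by (simp add: times_tensor_def tensor_lift_simps[OF cbilinear_tensor_left_mult])
  have distl: "a * (b + c) = a * b + a * c" for a b c :: "('a, 'b) tensor"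
    by (induction a rule: tensor_induct)
      (simp_all add: mult_elem tensor_left_mult_simps distr algebra_simps)
  have scl: "(z *\<^sub>C a) * b = z *\<^sub>C (a * b)" for z and a b :: "('a, 'b) tensor"
    by (simp add: times_tensor_def tensor_lift_simps[OF cbilinear_tensor_left_mult])
  have scr: "a * (z *\<^sub>C b) = z *\<^sub>C (a * b)" for z and a b :: "('a, 'b) tensor"
    by (induction a rule: tensor_induct)
      (simp_all add: mult_elem tensor_left_mult_simps distr scaleC_add_right)
  have st_elem: "star (x \<otimes> y) = star x \<otimes> star y" for x :: 'a and y :: 'b
    by (simp add: tensor_of.abs_eq star_tensor.abs_eq)
  have st_add: "star (a + b) = star a + star b" for a b :: "('a, 'b) tensor"
    by transfer (simp add: tensor_eq_def)
  fix a b c :: "('a, 'b) tensor" and z :: complex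
  show "a * b * c = a * (b * c)"
  proof (induction a rule: tensor_induct)
    case (tensor_of x y)
    show ?case
    proof (induction b rule: tensor_induct)
      case (tensor_of x' y')
      show ?case
        by (induction c rule: tensor_induct) (simp_all add: mult_elems mult.assoc distl)
    qed (simp add: distl distr)
  qed (simp add: distr)
  show "1 * a = a"
    unfolding one_tensor_def
    by (induction a rule: tensor_induct) (simp_all add: mult_elems distl)
  show "a * 1 = a"
    unfolding one_tensor_def
    by (induction a rule: tensor_induct) (simp_all add: mult_elems distr)
  show "(a + b) * c = a * c + b * c" by (rule distr)
  show "a * (b + c) = a * b + a * c" by (rule distl)
  show "(z *\<^sub>C a) * b = z *\<^sub>C (a * b)" by (rule scl)
  show "a * (z *\<^sub>C b) = z *\<^sub>C (a * b)" by (rule scr)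
  show "star (a + b) = star a + star b" by (rule st_add)
  show "star (z *\<^sub>C a) = cnj z *\<^sub>C star a"
  proof (induction a rule: tensor_induct)
    case (tensor_of x y)
    show ?case
      by (simp add: tensor_bilin(3)[symmetric] st_elem star_scaleC)
  qed (simp add: st_add scaleC_add_right)
  show "star (a * b) = star b * star a"
  proof (induction a rule: tensor_induct)
    case (tensor_of x y)
    show ?case
      by (induction b rule: tensor_induct)
        (simp_all add: mult_elems st_elem star_mult st_add distl distr)
  qed (simp add: st_add distl distr)
  show "star (star a) = a"
    by (induction a rule: tensor_induct) (simp_all add: st_elem st_add star_star)
  show "0 \<noteq> (1 :: ('a, 'b) tensor)"
  proof
    assume eq: "0 = (1 :: ('a, 'b) tensor)"
    obtain \<phi> :: "'a \<Rightarrow> complex" where \<phi>: "clinear \<phi>" "\<phi> 1 = 1"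
      by (rule clinear_separates[of 1]) auto
    obtain \<psi> :: "'b \<Rightarrow> complex" where \<psi>: "clinear \<psi>" "\<psi> 1 = 1"
      by (rule clinear_separates[of 1]) auto
    have bil: "cbilinear (\<lambda>x y. \<phi> x * \<psi> y)"
      by (rule cbilinearI)
        (simp_all add: clinear_add[OF \<phi>(1)] clinear_add[OF \<psi>(1)] clinear_scale[OF \<phi>(1)]
          clinear_scale[OF \<psi>(1)] scaleC_complex_def algebra_simps)
    have "tensor_lift (\<lambda>x y. \<phi> x * \<psi> y) 1 = 1"
      by (simp add: one_tensor_def tensor_lift_tensor_of[OF bil] \<phi> \<psi>)
    moreover have "tensor_lift (\<lambda>x y. \<phi> x * \<psi> y) 0 = 0"
      by (rule clinear_0[OF clinear_tensor_lift[OF bil]])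
    ultimately show False by (simp add: eq)
  qed
qed

end

lemma tensor_mult_tensor_of: "(x \<otimes> y) * (x' \<otimes> y') = (x * x') \<otimes> (y * y')"
  unfolding times_tensor_def tensor_lift_tensor_of[OF cbilinear_tensor_left_mult]
  by (rule tensor_left_mult_simps(1))

lemma star_tensor_of: "star (x \<otimes> y) = star x \<otimes> star y"
  by (simp add: tensor_of.abs_eq star_tensor.abs_eq)

definition tensor_functional ::
  "('a::complex_vector \<Rightarrow> complex) \<Rightarrow> ('b::complex_vector \<Rightarrow> complex) \<Rightarrow> ('a, 'b) tensor \<Rightarrow> complex" where
  "tensor_functional \<phi> \<psi> = tensor_lift (\<lambda>x y. \<phi> x * \<psi> y)"

definition tensor_map ::
  "('a::complex_vector \<Rightarrow> 'c::complex_vector) \<Rightarrow> ('b::complex_vector \<Rightarrow> 'd::complex_vector)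
    \<Rightarrow> ('a, 'b) tensor \<Rightarrow> ('c, 'd) tensor" where
  "tensor_map S T = tensor_lift (\<lambda>x y. S x \<otimes> T y)"

definition mult_map :: "('a::star_algebra, 'a) tensor \<Rightarrow> 'a" where
  "mult_map = tensor_lift (*)"


section \<open>Quantum sets\<close>

definition L2_inner :: "('a::star_algebra \<Rightarrow> complex) \<Rightarrow> 'a \<Rightarrow> 'a \<Rightarrow> complex" where
  "L2_inner \<psi> x y = \<psi> (star x * y)"

text \<open>Uniquely determined, as used below: the functionals involved are faithful, the spaces
  finite-dimensional.\<close>

definition L2_adjoint ::
  "('a::star_algebra \<Rightarrow> complex) \<Rightarrow> ('b::star_algebra \<Rightarrow> complex) \<Rightarrow> ('a \<Rightarrow> 'b) \<Rightarrow> 'b \<Rightarrow> 'a" where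
  "L2_adjoint \<phi> \<psi> f = (THE g. \<forall>x y. L2_inner \<psi> (f x) y = L2_inner \<phi> x (g y))"

definition faithful_state :: "('a::star_algebra \<Rightarrow> complex) \<Rightarrow> bool" where
  "faithful_state \<psi> \<longleftrightarrow> clinear \<psi> \<and> \<psi> 1 = 1 \<and>
    (\<forall>x. \<psi> (star x * x) \<in> \<real>\<^sub>\<ge>\<^sub>0) \<and> (\<forall>x. \<psi> (star x * x) = 0 \<longrightarrow> x = 0)"

definition comult :: "('a::star_algebra \<Rightarrow> complex) \<Rightarrow> 'a \<Rightarrow> ('a, 'a) tensor" where
  "comult \<psi> = L2_adjoint (tensor_functional \<psi> \<psi>) \<psi> mult_map"

definition is_delta_form :: "('a::star_algebra \<Rightarrow> complex) \<Rightarrow> real \<Rightarrow> bool" where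
  "is_delta_form \<psi> \<delta> \<longleftrightarrow> \<delta> \<ge> 0 \<and> (\<forall>x. mult_map (comult \<psi> x) = complex_of_real (\<delta>\<^sup>2) *\<^sub>C x)"

definition delta :: "('a::star_algebra \<Rightarrow> complex) \<Rightarrow> real" where
  "delta \<psi> = (THE \<delta>. is_delta_form \<psi> \<delta>)"

definition quantum_set :: "('b::fd_cstar_algebra \<Rightarrow> complex) \<Rightarrow> bool" where
  "quantum_set \<psi> \<longleftrightarrow> faithful_state \<psi> \<and> (\<exists>\<delta>. is_delta_form \<psi> \<delta>)"

definition schur ::
  "('a::star_algebra \<Rightarrow> complex) \<Rightarrow> ('a \<Rightarrow> 'a) \<Rightarrow> ('a \<Rightarrow> 'a) \<Rightarrow> 'a \<Rightarrow> 'a" where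
  "schur \<psi> S T x =
    complex_of_real (inverse ((delta \<psi>)\<^sup>2)) *\<^sub>C mult_map (tensor_map S T (comult \<psi> x))"

definition map_star :: "('a::star_algebra \<Rightarrow> 'a) \<Rightarrow> 'a \<Rightarrow> 'a" where
  "map_star T x = star (T (star x))"


section \<open>Quantum graphs\<close>

definition quantum_graph :: "('b::fd_cstar_algebra \<Rightarrow> complex) \<Rightarrow> ('b \<Rightarrow> 'b) \<Rightarrow> bool" where
  "quantum_graph \<psi> A \<longleftrightarrow> quantum_set \<psi> \<and> clinear A \<and> schur \<psi> A A = A"

definition real_graph :: "('b::fd_cstar_algebra \<Rightarrow> 'b) \<Rightarrow> bool" where
  "real_graph A \<longleftrightarrow> map_star A = A"

definition undirected :: "('b::fd_cstar_algebra \<Rightarrow> complex) \<Rightarrow> ('b \<Rightarrow> 'b) \<Rightarrow> bool" where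
  "undirected \<psi> A \<longleftrightarrow> real_graph A \<and> A = L2_adjoint \<psi> \<psi> A"

definition tracial :: "('b::fd_cstar_algebra \<Rightarrow> complex) \<Rightarrow> bool" where
  "tracial \<psi> \<longleftrightarrow> (\<forall>x y. \<psi> (x * y) = \<psi> (y * x))"

definition regular_graph ::
  "('b::fd_cstar_algebra \<Rightarrow> complex) \<Rightarrow> ('b \<Rightarrow> 'b) \<Rightarrow> complex \<Rightarrow> bool" where
  "regular_graph \<psi> A d \<longleftrightarrow> A 1 = d *\<^sub>C 1 \<and> L2_adjoint \<psi> \<psi> A 1 = d *\<^sub>C 1"

definition spectrum :: "('b::complex_vector \<Rightarrow> 'b) \<Rightarrow> complex set" where
  "spectrum A = {c. \<not> bij (\<lambda>x. A x - c *\<^sub>C x)}"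

text \<open>Geometric multiplicity; it is only used for self-adjoint maps.\<close>

definition eigenvalue_mult :: "('b::complex_vector \<Rightarrow> 'b) \<Rightarrow> complex \<Rightarrow> nat" where
  "eigenvalue_mult A c = complex_vector.dim {x. A x = c *\<^sub>C x}"

definition unital_star_hom :: "('a::star_algebra \<Rightarrow> 'b::star_algebra) \<Rightarrow> bool" where
  "unital_star_hom f \<longleftrightarrow> clinear f \<and> (\<forall>x y. f (x * y) = f x * f y) \<and>
    (\<forall>x. f (star x) = star (f x)) \<and> f 1 = 1"

definition tau3 :: "complex ^ 3 \<Rightarrow> complex" where
  "tau3 v = (v $ 1 + v $ 2 + v $ 3) / 3"

definition K2_T1_adjacency :: "complex ^ 3 ^ 3" where
  "K2_T1_adjacency = vector [vector [0, 1, 0], vector [1, 0, 0], vector [0, 0, 1]]"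

text \<open>A homomorphism onto \<open>K\<^sub>2 \<squnion> T\<^sub>1\<close> is given dually by \<open>f\<close>. The coordinates 1 and 2 belong to
  \<open>K\<^sub>2\<close>, coordinate 3 to \<open>T\<^sub>1\<close>; only \<open>K\<^sub>2\<close> has to be hit, so \<open>f\<close> may vanish on the third
  coordinate. \<open>schur tau3\<close> amounts to the entrywise product of 3x3 matrices.\<close>

definition has_bipartite_component ::
  "('b::fd_cstar_algebra \<Rightarrow> complex) \<Rightarrow> ('b \<Rightarrow> 'b) \<Rightarrow> bool" where
  "has_bipartite_component \<psi> A \<longleftrightarrow>
    (\<exists>f :: complex ^ 3 \<Rightarrow> 'b. unital_star_hom f \<and> inj_on f {v. v $ 3 = 0} \<and>
      (let B = L2_adjoint tau3 \<psi> f \<circ> A \<circ> f in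
        schur tau3 ((*v) K2_T1_adjacency) B = B))"

end

theory Submission
  imports Defs "HOL-Computational_Algebra.Fundamental_Theorem_Algebra"
begin

text \<open>
  Let \<open>e\<close> range over an orthonormal basis of \<open>B\<close>. Since \<open>\<psi>\<close> is a trace, the comultiplication is
  \<open>m\<^sup>\<dagger>(x) = \<Sum>\<^sub>e x e \<otimes> e\<^sup>*\<close> (\<open>comult_eq\<close>), and a factor may be moved from the left leg of
  this tensor to the right one (\<open>bilinear_sum_move\<close>). Therefore a real Schur idempotent satisfies
  \<open>A(x\<^sup>* y) = \<delta>\<^sup>-\<^sup>2 \<Sum>\<^sub>e A(e\<^sup>* x)\<^sup>* A(e\<^sup>* y)\<close>, which has the form \<open>\<Sum>\<^sub>e C\<^sub>e(x)\<^sup>* C\<^sub>e(y)\<close>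
  (\<open>kraus_family_exists\<close>). This explicit form of the complete positivity of \<open>A\<close> replaces any
  appeal to the order structure of \<open>B\<close>.

  Call \<open>p\<^sub>1, p\<^sub>2, p\<^sub>3\<close> the images of the point masses under a homomorphism
  \<open>f : \<complex>\<^sup>3 \<rightarrow> B\<close>. The homomorphism condition says that \<open>\<psi>(p\<^sub>k A(p\<^sub>i)) = 0\<close> whenever \<open>k\<close> and
  \<open>i\<close> are not adjacent in \<open>K\<^sub>2 \<squnion> T\<^sub>1\<close>. By positivity \<open>A(p\<^sub>i) p\<^sub>k = 0\<close> for these pairs, and
  multiplying \<open>A(p\<^sub>1) + A(p\<^sub>2) + A(p\<^sub>3) = d 1\<close> by \<open>p\<^sub>1\<close> and by \<open>p\<^sub>2\<close> shows that \<open>A\<close> exchanges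
  \<open>p\<^sub>1\<close> and \<open>p\<^sub>2\<close> up to the factor \<open>d\<close>. So a bipartite component is the same as a pair of
  orthogonal nonzero projections \<open>p, q\<close> with \<open>A p = d q\<close> and \<open>A q = d p\<close>
  (\<open>has_bipartite_component_iff\<close>), and then \<open>p - q\<close> is an eigenvector for \<open>-d\<close>.

  Conversely let \<open>d \<noteq> 0\<close> and \<open>A x = - d x\<close>; one may take \<open>x\<close> self-adjoint. As \<open>A\<close> multiplies the
  trace by \<open>d\<close>, equality holds under \<open>\<psi>\<close> in the Kadison-Schwarz inequality for \<open>x\<close> and the unital
  completely positive map \<open>A / d\<close>, so \<open>x\<close> lies in the multiplicative domain of that map:
  \<open>A(x y) = - x A(y)\<close> for all \<open>y\<close> (\<open>A_mult_extremal_eigenelement\<close>). Hence odd polynomials in \<open>x\<close>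
  are eigenvectors for \<open>-d\<close> and even ones for \<open>d\<close>.
  In finite dimension some odd polynomial \<open>s\<close> in \<open>x\<close> is self-adjoint and nonzero with
  \<open>s\<^sup>3 = s\<close>: an eigenvector of multiplication by \<open>x\<^sup>2\<close> on the odd polynomials, suitably
  normalised (\<open>selfadjoint_eigenelement\<close>, \<open>selfadjoint_cube_eigenvalue\<close>). The projections
  \<open>(s\<^sup>2 \<plusminus> s) / 2\<close> onto its eigenvalues \<open>\<plusminus>1\<close> are exchanged by \<open>A / d\<close>.

  If \<open>d = 0\<close>, complete positivity and \<open>A 1 = 0\<close> force \<open>A = 0\<close>. Both conditions then say that \<open>B\<close>
  is not one-dimensional, for an algebra of larger dimension contains a projection
  other than \<open>0\<close> and \<open>1\<close> (\<open>nonscalar_imp_bipartite\<close>).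
\<close>

section \<open>Faithful states and their inner products\<close>

lemma star_0 [simp]: "star (0 :: 'a::star_algebra) = 0"
  using star_scaleC[of 0 "0::'a"] by simp

lemma star_1 [simp]: "star (1 :: 'a::star_algebra) = 1"
  by (metis mult_1 mult_1_right star_mult star_star)

lemma star_sum: "star (sum f S) = (\<Sum>i\<in>S. star (f i :: 'a::star_algebra))"
  by (induction S rule: infinite_finite_induct) (simp_all add: star_add)

lemma star_minus: "star (- x) = - star (x :: 'a::star_algebra)"
  using star_scaleC[of "-1" x] by simp

lemma star_diff: "star (x - y) = star x - star (y :: 'a::star_algebra)"
  using star_add[of x "- y"] by (simp add: star_minus)

lemma star_power: "star (x ^ n) = star (x :: 'a::star_algebra) ^ n"
  by (induction n) (simp_all add: star_mult power_commutes)

locale state =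
  fixes \<psi> :: "'a::star_algebra \<Rightarrow> complex"
  assumes faithful: "faithful_state \<psi>"
begin

lemma clinear_state: "clinear \<psi>" and state_1 [simp]: "\<psi> 1 = 1"
  and positive: "\<psi> (star x * x) \<in> \<real>\<^sub>\<ge>\<^sub>0" and definite: "\<psi> (star x * x) = 0 \<Longrightarrow> x = 0"
  using faithful by (auto simp: faithful_state_def)

lemma state_simps [simp]:
  "\<psi> (x + y) = \<psi> x + \<psi> y" "\<psi> (c *\<^sub>C x) = c * \<psi> x" "\<psi> 0 = 0"
  "\<psi> (x - y) = \<psi> x - \<psi> y" "\<psi> (- x) = - \<psi> x" "\<psi> (sum f S) = (\<Sum>i\<in>S. \<psi> (f i))"
  using clinear_state
  by (simp_all add: clinear_add clinear_scale clinear_0 complex_vector.linear_diff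
      complex_vector.linear_neg complex_vector.linear_sum scaleC_complex_def)

text \<open>Polarise the reality of \<open>\<psi> (star z * z)\<close> at \<open>z = 1 + x\<close> and \<open>z = 1 + \<i> x\<close>.\<close>

lemma state_star: "\<psi> (star x) = cnj (\<psi> x)"
proof -
  have real: "Im (\<psi> (star z * z)) = 0" for z
    using positive[of z] by (simp add: complex_nonneg_Reals_iff)
  have "Im (\<psi> (star (1 + x) * (1 + x))) = Im (\<psi> (star x) + \<psi> x)"
    using real[of x] by (simp add: star_add algebra_simps)
  moreover have "Im (\<psi> (star (1 + \<i> *\<^sub>C x) * (1 + \<i> *\<^sub>C x))) = Im (\<i> * (\<psi> x - \<psi> (star x)))"
    using real[of x]
    by (simp add: star_add star_scaleC scaleC_mult_left scaleC_mult_right algebra_simps)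
  ultimately show ?thesis
    using real[of "1 + x"] real[of "1 + \<i> *\<^sub>C x"] by (simp add: complex_eq_iff)
qed

lemma L2_inner_simps:
  "L2_inner \<psi> x (y + z) = L2_inner \<psi> x y + L2_inner \<psi> x z"
  "L2_inner \<psi> (x + y) z = L2_inner \<psi> x z + L2_inner \<psi> y z"
  "L2_inner \<psi> x (c *\<^sub>C y) = c * L2_inner \<psi> x y"
  "L2_inner \<psi> (c *\<^sub>C x) y = cnj c * L2_inner \<psi> x y"
  "L2_inner \<psi> x (y - z) = L2_inner \<psi> x y - L2_inner \<psi> x z"
  "L2_inner \<psi> (x - y) z = L2_inner \<psi> x z - L2_inner \<psi> y z"
  "L2_inner \<psi> x (sum f S) = (\<Sum>i\<in>S. L2_inner \<psi> x (f i))"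
  "L2_inner \<psi> (sum f S) x = (\<Sum>i\<in>S. L2_inner \<psi> (f i) x)"
  by (simp_all add: L2_inner_def star_add star_diff star_sum star_scaleC scaleC_mult_left
      scaleC_mult_right algebra_simps sum_distrib_left sum_distrib_right)

lemma L2_inner_sym: "cnj (L2_inner \<psi> x y) = L2_inner \<psi> y x"
  by (simp add: L2_inner_def state_star[symmetric] star_mult star_star)

lemma L2_inner_eq_iff: "(\<forall>x. L2_inner \<psi> x y = L2_inner \<psi> x z) \<longleftrightarrow> y = z"
proof
  assume "\<forall>x. L2_inner \<psi> x y = L2_inner \<psi> x z"
  then have "L2_inner \<psi> (y - z) (y - z) = 0" by (simp add: L2_inner_simps)
  then show "y = z" using definite by (force simp: L2_inner_def)
qed simp

lemma sum_squares_eq_0: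
  assumes "finite S" and "(\<Sum>i\<in>S. \<psi> (star (f i) * f i)) = 0" and "i \<in> S"
  shows "f i = 0"
proof -
  have pos: "Re (\<psi> (star x * x)) \<ge> 0" "Im (\<psi> (star x * x)) = 0" for x
    using positive[of x] by (simp_all add: complex_nonneg_Reals_iff)
  have "(\<Sum>i\<in>S. Re (\<psi> (star (f i) * f i))) = 0"
    using assms(2) by (metis Re_sum zero_complex.sel(1))
  then have "Re (\<psi> (star (f i) * f i)) = 0"
    using pos assms by (simp add: sum_nonneg_eq_0_iff)
  then show ?thesis using pos definite by (simp add: complex_eq_iff)
qed

text \<open>Gram-Schmidt; the last property says that \<open>S\<close> lies in the span of \<open>E\<close>.\<close>

lemma orthonormal_set_exists:
  assumes "finite S"
  shows "\<exists>E. finite E \<and> (\<forall>e\<in>E. \<forall>e'\<in>E. L2_inner \<psi> e e' = (if e = e' then 1 else 0)) \<and>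
    (\<forall>x\<in>S. x = (\<Sum>e\<in>E. L2_inner \<psi> e x *\<^sub>C e))"
  using assms
proof (induction S)
  case empty
  show ?case by (rule exI[of _ "{}"]) simp
next
  case (insert v S)
  then obtain E where E: "finite E"
    "\<And>e e'. e \<in> E \<Longrightarrow> e' \<in> E \<Longrightarrow> L2_inner \<psi> e e' = (if e = e' then 1 else 0)"
    "\<And>x. x \<in> S \<Longrightarrow> x = (\<Sum>e\<in>E. L2_inner \<psi> e x *\<^sub>C e)" by metis
  define w where "w = v - (\<Sum>e\<in>E. L2_inner \<psi> e v *\<^sub>C e)"
  have orth: "L2_inner \<psi> e w = 0" if "e \<in> E" for e
    using that E(1) by (simp add: w_def L2_inner_simps E(2) if_distrib[of "(*) _"] cong: if_cong)
  show ?case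
  proof (cases "w = 0")
    case True
    then show ?thesis using E by (intro exI[of _ E]) (auto simp: w_def)
  next
    case False
    define r where "r = Re (L2_inner \<psi> w w)"
    have r: "L2_inner \<psi> w w = complex_of_real r" "r > 0"
      using positive[of w] definite[of w] False
      by (auto simp: r_def L2_inner_def complex_nonneg_Reals_iff complex_eq_iff order_le_less)
    define e0 where "e0 = complex_of_real (1 / sqrt r) *\<^sub>C w"
    have e0: "L2_inner \<psi> e0 e0 = 1"
      using r by (simp add: e0_def L2_inner_simps flip: of_real_mult)
    have e0_orth: "L2_inner \<psi> e e0 = 0" "L2_inner \<psi> e0 e = 0" if "e \<in> E" for e
      using orth[OF that] L2_inner_sym[of e w] by (simp_all add: e0_def L2_inner_simps)
    have notin: "e0 \<notin> E" using e0_orth e0 by force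
    have inner_e0: "L2_inner \<psi> e0 (\<Sum>e\<in>E. c e *\<^sub>C e) = 0" for c
      by (simp add: L2_inner_simps e0_orth)
    have v: "v = (\<Sum>e\<in>E. L2_inner \<psi> e v *\<^sub>C e) + complex_of_real (sqrt r) *\<^sub>C e0"
      using r by (simp add: w_def e0_def scaleC_scaleC scaleC_one flip: of_real_mult)
    have "L2_inner \<psi> e0 v = complex_of_real (sqrt r)"
      by (subst v) (simp add: L2_inner_simps(1,3) inner_e0 e0)
    then have "v = (\<Sum>e\<in>insert e0 E. L2_inner \<psi> e v *\<^sub>C e)"
      using v E(1) notin by (simp add: add.commute)
    moreover have "x = (\<Sum>e\<in>insert e0 E. L2_inner \<psi> e x *\<^sub>C e)" if "x \<in> S" for x
    proof -
      have "L2_inner \<psi> e0 x = 0" by (subst E(3)[OF that]) (rule inner_e0)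
      then show ?thesis using E(1) notin E(3)[OF that] by simp
    qed
    ultimately show ?thesis
      using E(1,2) e0 e0_orth notin by (intro exI[of _ "insert e0 E"]) auto
  qed
qed

end

section \<open>Adjoints and the comultiplication of a trace\<close>

locale traced_algebra = state \<psi> for \<psi> :: "'a::star_algebra \<Rightarrow> complex" +
  fixes E :: "'a set"
  assumes trace: "\<psi> (x * y) = \<psi> (y * x)"
    and finite_basis: "finite E"
    and orthonormal: "e \<in> E \<Longrightarrow> e' \<in> E \<Longrightarrow> L2_inner \<psi> e e' = (if e = e' then 1 else 0)"
    and expansion: "(\<Sum>e\<in>E. L2_inner \<psi> e x *\<^sub>C e) = x"
begin

lemma parseval: "(\<Sum>e\<in>E. L2_inner \<psi> x e * L2_inner \<psi> e y) = L2_inner \<psi> x y"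
proof -
  have "L2_inner \<psi> x (\<Sum>e\<in>E. L2_inner \<psi> e y *\<^sub>C e) = (\<Sum>e\<in>E. L2_inner \<psi> x e * L2_inner \<psi> e y)"
    by (simp add: L2_inner_simps mult.commute)
  then show ?thesis by (simp add: expansion)
qed

text \<open>The adjoint is a definite description, so its defining equation needs a witness: expanding the
  argument of \<open>f\<close> in the basis \<open>E\<close> gives one, and nondegeneracy makes it unique.\<close>

lemma L2_adjoint_inner:
  fixes \<phi> :: "'c::star_algebra \<Rightarrow> complex"
  assumes \<phi>: "faithful_state \<phi>" and f: "clinear f"
  shows "L2_inner \<phi> (f x) y = L2_inner \<psi> x (L2_adjoint \<psi> \<phi> f y)"
proof -
  interpret \<phi>: state \<phi> by unfold_locales (rule \<phi>)
  define g where "g y = (\<Sum>e\<in>E. L2_inner \<phi> (f e) y *\<^sub>C e)" for y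
  have g: "L2_inner \<phi> (f x) y = L2_inner \<psi> x (g y)" for x y
  proof -
    have "f x = (\<Sum>e\<in>E. L2_inner \<psi> e x *\<^sub>C f e)"
      by (subst expansion[of x, symmetric])
        (simp add: complex_vector.linear_sum[OF f] clinear_scale[OF f])
    then show ?thesis
      by (simp add: g_def L2_inner_simps \<phi>.L2_inner_simps L2_inner_sym mult.commute)
  qed
  have "L2_adjoint \<psi> \<phi> f = g"
    unfolding L2_adjoint_def
  proof (rule the_equality)
    fix g' assume "\<forall>x y. L2_inner \<phi> (f x) y = L2_inner \<psi> x (g' y)"
    then show "g' = g" using g L2_inner_eq_iff by (metis ext)
  qed (simp add: g)
  then show ?thesis using g by simp
qed

lemma clinear_L2_adjoint:
  assumes \<phi>: "faithful_state \<phi>" and f: "clinear f"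
  shows "clinear (L2_adjoint \<psi> \<phi> f)"
proof -
  interpret \<phi>: state \<phi> by unfold_locales (rule \<phi>)
  note adj = L2_adjoint_inner[OF \<phi> f, symmetric]
  show ?thesis
  proof (rule clinearI)
    fix x y c
    have "\<forall>z. L2_inner \<psi> z (L2_adjoint \<psi> \<phi> f (x + y)) =
        L2_inner \<psi> z (L2_adjoint \<psi> \<phi> f x + L2_adjoint \<psi> \<phi> f y)"
      unfolding L2_inner_simps adj \<phi>.L2_inner_simps by simp
    then show "L2_adjoint \<psi> \<phi> f (x + y) = L2_adjoint \<psi> \<phi> f x + L2_adjoint \<psi> \<phi> f y"
      unfolding L2_inner_eq_iff .
    have "\<forall>z. L2_inner \<psi> z (L2_adjoint \<psi> \<phi> f (c *\<^sub>C x)) =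
        L2_inner \<psi> z (c *\<^sub>C L2_adjoint \<psi> \<phi> f x)"
      unfolding L2_inner_simps adj \<phi>.L2_inner_simps by simp
    then show "L2_adjoint \<psi> \<phi> f (c *\<^sub>C x) = c *\<^sub>C L2_adjoint \<psi> \<phi> f x"
      unfolding L2_inner_eq_iff .
  qed
qed

text \<open>\<open>\<Sum>\<^sub>e x e \<otimes> e\<^sup>* = \<Sum>\<^sub>e e \<otimes> e\<^sup>* x\<close>, stated for the values of bilinear maps: expand \<open>x e\<close> on
  the left and \<open>e\<^sup>* x\<close> on the right in the basis, and both sides have the same coefficients.\<close>

lemma bilinear_sum_move:
  assumes \<beta>: "cbilinear \<beta>"
  shows "(\<Sum>e\<in>E. \<beta> (x * e) (star e)) = (\<Sum>e\<in>E. \<beta> e (star e * x))"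
proof -
  have lin: "\<beta> (\<Sum>e\<in>E. c e *\<^sub>C v e) z = (\<Sum>e\<in>E. c e *\<^sub>C \<beta> (v e) z)"
    "\<beta> z (\<Sum>e\<in>E. c e *\<^sub>C v e) = (\<Sum>e\<in>E. c e *\<^sub>C \<beta> z (v e))" for c v z
    using \<beta> unfolding cbilinear_def
    by (simp_all add: complex_vector.linear_sum clinear_scale
        complex_vector.linear_sum[of "\<lambda>x. \<beta> x z"] clinear_scale[of "\<lambda>x. \<beta> x z"])
  have right: "star e * x = (\<Sum>e'\<in>E. L2_inner \<psi> e (x * e') *\<^sub>C star e')" for e
  proof -
    have "star e * x = star (\<Sum>e'\<in>E. L2_inner \<psi> e' (star x * e) *\<^sub>C e')"
      by (simp add: expansion star_mult star_star)
    also have "\<dots> = (\<Sum>e'\<in>E. L2_inner \<psi> e (x * e') *\<^sub>C star e')"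
      by (simp add: star_sum star_scaleC L2_inner_sym L2_inner_def star_mult star_star mult.assoc
        flip: state_star)
    finally show ?thesis .
  qed
  have "(\<Sum>e\<in>E. \<beta> (x * e) (star e)) =
      (\<Sum>e\<in>E. \<Sum>e'\<in>E. L2_inner \<psi> e' (x * e) *\<^sub>C \<beta> e' (star e))"
    by (subst expansion[of "x * _", symmetric]) (simp add: lin)
  also have "\<dots> = (\<Sum>e\<in>E. \<beta> e (star e * x))"
    by (subst sum.swap) (simp add: right lin)
  finally show ?thesis .
qed

lemma cbilinear_functional: "cbilinear (\<lambda>x y. \<psi> x * \<psi> y)"
  by (rule cbilinearI) (simp_all add: scaleC_complex_def algebra_simps)

lemmas tensor_functional_simps =
  tensor_lift_simps[OF cbilinear_functional, folded tensor_functional_def]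

lemmas mult_map_simps = tensor_lift_simps[OF cbilinear_star_mult, folded mult_map_def]

lemma clinear_mult_map: "clinear (mult_map :: ('a,'a) tensor \<Rightarrow> 'a)"
  unfolding mult_map_def by (rule clinear_tensor_lift[OF cbilinear_star_mult])

lemma tensor_inner:
  "L2_inner (tensor_functional \<psi> \<psi>) (a \<otimes> b) (x \<otimes> y) = L2_inner \<psi> a x * L2_inner \<psi> b y"
  by (simp add: L2_inner_def star_tensor_of tensor_mult_tensor_of tensor_functional_simps)

lemma tensor_inner_add:
  "L2_inner (tensor_functional \<psi> \<psi>) s (t + t') =
    L2_inner (tensor_functional \<psi> \<psi>) s t + L2_inner (tensor_functional \<psi> \<psi>) s t'"
  "L2_inner (tensor_functional \<psi> \<psi>) (s + s') t =
    L2_inner (tensor_functional \<psi> \<psi>) s t + L2_inner (tensor_functional \<psi> \<psi>) s' t"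
  by (simp_all add: L2_inner_def star_add distrib_left distrib_right tensor_functional_simps)

lemma tensor_inner_sum:
  "L2_inner (tensor_functional \<psi> \<psi>) s (\<Sum>i\<in>S. f i) =
    (\<Sum>i\<in>S. L2_inner (tensor_functional \<psi> \<psi>) s (f i))"
proof -
  have zero: "L2_inner (tensor_functional \<psi> \<psi>) s 0 = 0"
    using tensor_inner_add(1)[of s 0 0] by simp
  show ?thesis
    by (induction S rule: infinite_finite_induct) (simp_all add: tensor_inner_add zero)
qed

text \<open>The elementary tensors of basis vectors span the tensor product, so tensors are determined by
  their inner products with these; this makes the adjoint of the multiplication unique.\<close>

lemma tensor_expansion:
  "(\<Sum>e\<in>E. \<Sum>e'\<in>E. L2_inner (tensor_functional \<psi> \<psi>) (e \<otimes> e') t *\<^sub>C (e \<otimes> e')) = t"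
proof (induction t rule: tensor_induct)
  case (tensor_of x y)
  have sum_left: "(\<Sum>e\<in>E. f e) \<otimes> y = (\<Sum>e\<in>E. f e \<otimes> y)" for f and y :: 'a
    using complex_vector.linear_sum tensor_of_bilinear unfolding cbilinear_def by fast
  have sum_right: "x \<otimes> (\<Sum>e\<in>E. f e) = (\<Sum>e\<in>E. x \<otimes> f e)" for f and x :: 'a
    using complex_vector.linear_sum tensor_of_bilinear unfolding cbilinear_def by fast
  have "x \<otimes> y = (\<Sum>e\<in>E. L2_inner \<psi> e x *\<^sub>C e) \<otimes> (\<Sum>e\<in>E. L2_inner \<psi> e y *\<^sub>C e)"
    by (simp add: expansion)
  also have "\<dots> = (\<Sum>e\<in>E. \<Sum>e'\<in>E. (L2_inner \<psi> e x * L2_inner \<psi> e' y) *\<^sub>C (e \<otimes> e'))"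
    unfolding sum_left unfolding sum_right
    by (simp add: tensor_bilin scaleC_scaleC mult.commute)
  finally show ?case unfolding tensor_inner by (rule sym)
next
  case (add s t)
  then show ?case by (simp add: tensor_inner_add scaleC_add_left sum.distrib)
qed

text \<open>For elementary tensors \<open>\<langle>a \<otimes> b | \<Sum>\<^sub>e y e \<otimes> e\<^sup>*\<rangle>\<close> becomes, by traciality,
  \<open>\<Sum>\<^sub>e \<langle>y\<^sup>* a | e\<rangle> \<langle>e | b\<^sup>*\<rangle>\<close>, which Parseval's identity collapses to \<open>\<langle>a b | y\<rangle>\<close>.\<close>

lemma comult_eq: "comult \<psi> y = (\<Sum>e\<in>E. (y * e) \<otimes> star e)"
proof -
  define g where "g y = (\<Sum>e\<in>E. (y * e) \<otimes> star e)" for y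
  have g: "L2_inner \<psi> (mult_map t) y = L2_inner (tensor_functional \<psi> \<psi>) t (g y)" for t y
  proof (induction t rule: tensor_induct)
    case (tensor_of a b)
    have "L2_inner (tensor_functional \<psi> \<psi>) (a \<otimes> b) (g y) =
        (\<Sum>e\<in>E. L2_inner \<psi> (star y * a) e * L2_inner \<psi> e (star b))"
      by (simp add: g_def tensor_inner_sum tensor_inner)
        (simp add: L2_inner_def star_mult star_star mult.assoc trace[of "star b"])
    also have "\<dots> = L2_inner \<psi> (a * b) y"
      unfolding parseval
      by (simp add: L2_inner_def star_mult star_star mult.assoc trace[of "star b"])
    finally show ?case by (simp add: mult_map_simps)
  next
    case (add s t)
    then show ?case by (simp add: mult_map_simps L2_inner_simps tensor_inner_add)
  qed
  have "comult \<psi> = g"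
    unfolding comult_def L2_adjoint_def
  proof (rule the_equality)
    fix g' assume "\<forall>t y. L2_inner \<psi> (mult_map t) y = L2_inner (tensor_functional \<psi> \<psi>) t (g' y)"
    then have "L2_inner (tensor_functional \<psi> \<psi>) t (g' y) = L2_inner (tensor_functional \<psi> \<psi>) t (g y)"
      for t y by (simp add: g)
    then show "g' = g" by (metis (no_types, lifting) ext tensor_expansion sum.cong)
  qed (simp add: g)
  then show ?thesis by (simp add: g_def)
qed

lemma mult_comult: "mult_map (comult \<psi> x) = (\<Sum>e\<in>E. x * e * star e)"
  by (simp add: comult_eq complex_vector.linear_sum[OF clinear_mult_map] mult_map_simps)

lemma schur_eq:
  assumes S: "clinear S" and T: "clinear T"
  shows "schur \<psi> S T x =
    complex_of_real (inverse ((delta \<psi>)\<^sup>2)) *\<^sub>C (\<Sum>e\<in>E. S (x * e) * T (star e))"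
proof -
  have bil: "cbilinear (\<lambda>x y. S x \<otimes> T y)"
    by (rule cbilinearI)
      (simp_all add: tensor_bilin clinear_add[OF S] clinear_add[OF T] clinear_scale[OF S]
        clinear_scale[OF T])
  show ?thesis
    by (simp add: schur_def comult_eq tensor_map_def
        complex_vector.linear_sum[OF clinear_tensor_lift[OF bil]]
        complex_vector.linear_sum[OF clinear_mult_map] tensor_lift_simps[OF bil] mult_map_simps)
qed

text \<open>Splitting the argument between the two factors is what turns Schur idempotence into complete
  positivity.\<close>

lemma schur_mult:
  assumes S: "clinear S" and T: "clinear T"
  shows "schur \<psi> S T (x * y) =
    complex_of_real (inverse ((delta \<psi>)\<^sup>2)) *\<^sub>C (\<Sum>e\<in>E. S (x * e) * T (star e * y))"
proof -
  have "cbilinear (\<lambda>a b. S (x * a) * T b)"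
    by (rule cbilinearI)
      (simp_all add: distrib_left distrib_right scaleC_mult_right scaleC_mult_left clinear_add[OF S]
        clinear_add[OF T] clinear_scale[OF S] clinear_scale[OF T])
  from bilinear_sum_move[OF this, of y] show ?thesis by (simp add: schur_eq[OF S T] mult.assoc)
qed

lemma delta_eqI:
  assumes "\<delta> \<ge> 0" and "\<And>x. (\<Sum>e\<in>E. x * e * star e) = complex_of_real (\<delta>\<^sup>2) *\<^sub>C x"
  shows "delta \<psi> = \<delta>"
  unfolding delta_def
proof (rule the_equality)
  show "is_delta_form \<psi> \<delta>" using assms by (simp add: is_delta_form_def mult_comult)
  fix \<delta>' assume "is_delta_form \<psi> \<delta>'"
  then have nonneg: "\<delta>' \<ge> 0" and
    "mult_map (comult \<psi> 1) = complex_of_real (\<delta>'\<^sup>2) *\<^sub>C (1 :: 'a)"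
    by (auto simp: is_delta_form_def)
  moreover have "mult_map (comult \<psi> 1) = complex_of_real (\<delta>\<^sup>2) *\<^sub>C (1 :: 'a)"
    by (simp only: mult_comult assms(2))
  ultimately have "\<psi> (complex_of_real (\<delta>'\<^sup>2) *\<^sub>C 1) = \<psi> (complex_of_real (\<delta>\<^sup>2) *\<^sub>C 1)"
    by metis
  then have "\<delta>'\<^sup>2 = \<delta>\<^sup>2"
    by (simp only: state_simps state_1 mult_1_right of_real_eq_iff)
  then show "\<delta>' = \<delta>" using nonneg assms(1) by (simp add: power2_eq_iff_nonneg)
qed

end


section \<open>The entrywise product on three points\<close>

lemma vec3_star_algebra_simps [simp]:
  "(c *\<^sub>C (v :: complex ^ 3)) $ i = c * v $ i" "star v $ i = cnj (v $ i)" "(v * w) $ i = v $ i * w $ i"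
  by (simp_all add: scaleC_vec_def scaleC_complex_def star_vec_def star_complex_def)

lemma vec3_expansion: "(\<Sum>i\<in>UNIV. (v $ i) *\<^sub>C axis i 1) = (v :: complex ^ 3)"
  by (simp add: vec_eq_iff axis_def if_distrib[of "(*) _"] cong: if_cong)

text \<open>The point masses are orthogonal of squared norm \<open>1/3\<close>.\<close>

definition tau3_basis :: "(complex ^ 3) set" where
  "tau3_basis = range (\<lambda>i. complex_of_real (sqrt 3) *\<^sub>C axis i 1)"

lemma sum_tau3_basis:
  "(\<Sum>e\<in>tau3_basis. F e) = (\<Sum>i\<in>UNIV. F (complex_of_real (sqrt 3) *\<^sub>C axis i 1))"
proof -
  have "inj (\<lambda>i :: 3. complex_of_real (sqrt 3) *\<^sub>C axis i (1 :: complex))"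
    by (rule injI) (auto simp: axis_eq_axis)
  then show ?thesis unfolding tau3_basis_def by (subst sum.reindex) auto
qed

lemma tau3_inner: "L2_inner tau3 x y = (\<Sum>i\<in>UNIV. cnj (x $ i) * y $ i) / 3"
  by (simp add: L2_inner_def tau3_def sum_3)

lemma sqrt3_square: "complex_of_real (sqrt 3) * complex_of_real (sqrt 3) = 3"
  by (simp flip: of_real_mult)

interpretation tau3: traced_algebra tau3 tau3_basis
proof
  show "faithful_state tau3"
    unfolding faithful_state_def
  proof (intro conjI allI impI)
    show "clinear tau3"
      by (rule clinearI) (simp_all add: tau3_def scaleC_complex_def algebra_simps add_divide_distrib)
    show "tau3 1 = 1" by (simp add: tau3_def)
    fix x
    have eq: "tau3 (star x * x) =
        complex_of_real (((cmod (x $ 1))\<^sup>2 + (cmod (x $ 2))\<^sup>2 + (cmod (x $ 3))\<^sup>2) / 3)"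
      by (simp add: tau3_def complex_norm_square mult.commute del: of_real_power)
    show "tau3 (star x * x) \<in> \<real>\<^sub>\<ge>\<^sub>0"
      unfolding eq nonneg_Reals_of_real_iff by simp
    assume "tau3 (star x * x) = 0"
    then have "(cmod (x $ 1))\<^sup>2 + (cmod (x $ 2))\<^sup>2 + (cmod (x $ 3))\<^sup>2 = 0"
      unfolding eq of_real_eq_0_iff by simp
    then show "x = 0"
      by (simp add: vec_eq_iff forall_3 add_nonneg_eq_0_iff)
  qed
  show "tau3 (x * y) = tau3 (y * x)" for x y
    by (simp add: tau3_def mult.commute)
  show "finite tau3_basis" by (simp add: tau3_basis_def)
  show "L2_inner tau3 e e' = (if e = e' then 1 else 0)" if "e \<in> tau3_basis" "e' \<in> tau3_basis" for e e'
  proof -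
    obtain i j where ij: "e = complex_of_real (sqrt 3) *\<^sub>C axis i 1"
      "e' = complex_of_real (sqrt 3) *\<^sub>C axis j 1"
      using \<open>e \<in> tau3_basis\<close> \<open>e' \<in> tau3_basis\<close> by (auto simp: tau3_basis_def)
    show ?thesis
      using exhaust_3[of i] exhaust_3[of j] sqrt3_square
      by (auto simp: ij tau3_inner sum_3 axis_def axis_eq_axis vec_eq_iff forall_3)
  qed
  show "(\<Sum>e\<in>tau3_basis. L2_inner tau3 e x *\<^sub>C e) = x" for x
    unfolding sum_tau3_basis
    using sqrt3_square
    by (simp add: vec_eq_iff tau3_inner forall_3 sum_3 axis_def)
qed

lemma delta_tau3: "delta tau3 = sqrt 3"
  by (rule tau3.delta_eqI, simp, unfold sum_tau3_basis)
    (auto simp: vec_eq_iff forall_3 sum_3 axis_def sqrt3_square)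

text \<open>Each basis vector is \<open>\<surd>3\<close> times a point mass, and these factors cancel \<open>\<delta>\<^sup>-\<^sup>2 = 1/3\<close>.\<close>

lemma schur_tau3:
  assumes "clinear B"
  shows "schur tau3 ((*v) M) B v $ k = (\<Sum>i\<in>UNIV. v $ i * (M $ k $ i * B (axis i 1) $ k))"
proof -
  have M: "clinear ((*v) M)"
    by (rule clinearI)
      (simp_all add: vec_eq_iff matrix_vector_mult_def sum_distrib_left distrib_left sum.distrib
        mult.left_commute)
  have prod: "v * s *\<^sub>C axis i 1 = (s * v $ i) *\<^sub>C axis i 1" for s i
    by (simp add: vec_eq_iff axis_def)
  have star: "star (s *\<^sub>C axis i 1) = cnj s *\<^sub>C (axis i 1 :: complex ^ 3)" for s i
    by (simp add: vec_eq_iff axis_def)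
  have "(M *v axis i 1) $ k = M $ k $ i" for i
    by (simp add: matrix_vector_mult_def axis_def if_distrib[of "(*) _"] cong: if_cong)
  moreover have sqrt3: "complex_of_real (sqrt 3) * (complex_of_real (sqrt 3) * z) = 3 * z" for z
    by (simp add: sqrt3_square flip: mult.assoc)
  ultimately show ?thesis
    unfolding tau3.schur_eq[OF M assms] sum_tau3_basis delta_tau3 prod star
      clinear_scale[OF M] clinear_scale[OF assms]
    by (simp add: sum_distrib_left sum_3 algebra_simps sqrt3)
qed

text \<open>Entrywise multiplication by a 0-1 matrix fixes exactly the matrices supported on it.\<close>

lemma schur_K2_T1_fixed_iff:
  assumes B: "clinear B"
  shows "schur tau3 ((*v) K2_T1_adjacency) B = B \<longleftrightarrow>
    (\<forall>k i. K2_T1_adjacency $ k $ i = 0 \<longrightarrow> B (axis i 1) $ k = 0)"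
    (is "?L \<longleftrightarrow> ?R")
proof
  assume L: ?L
  show ?R
  proof (intro allI impI)
    fix k i :: 3 assume M: "K2_T1_adjacency $ k $ i = 0"
    have "B (axis i 1) $ k =
        (\<Sum>j\<in>UNIV. (axis i 1 :: complex ^ 3) $ j * (K2_T1_adjacency $ k $ j * B (axis j 1) $ k))"
      using schur_tau3[OF B, of K2_T1_adjacency "axis i 1" k] unfolding L .
    also have "\<dots> = (\<Sum>j\<in>UNIV. if j = i then K2_T1_adjacency $ k $ j * B (axis j 1) $ k else 0)"
      by (rule sum.cong) (simp_all add: axis_def)
    finally show "B (axis i 1) $ k = 0" using M by simp
  qed
next
  assume R: ?R
  have entry_cases: "K2_T1_adjacency $ k $ i = 0 \<or> K2_T1_adjacency $ k $ i = 1" for k i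
    using exhaust_3[of k] exhaust_3[of i] by (auto simp: K2_T1_adjacency_def)
  have entry: "K2_T1_adjacency $ k $ i * B (axis i 1) $ k = B (axis i 1) $ k" for k i
  proof (cases "K2_T1_adjacency $ k $ i = 0")
    case True
    then show ?thesis using R[rule_format, OF True] by simp
  next
    case False
    then have "K2_T1_adjacency $ k $ i = 1" using entry_cases by blast
    then show ?thesis by simp
  qed
  have "B v $ k = (\<Sum>i\<in>UNIV. v $ i * B (axis i 1) $ k)" for v k
  proof -
    have "B v = B (\<Sum>i\<in>UNIV. (v $ i) *\<^sub>C axis i 1)" by (simp add: vec3_expansion)
    then show ?thesis
      by (simp add: complex_vector.linear_sum[OF B] clinear_scale[OF B])
  qed
  then have "schur tau3 ((*v) K2_T1_adjacency) B v $ k = B v $ k" for v k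
    unfolding schur_tau3[OF B] entry by (rule sym)
  then show ?L by (simp add: fun_eq_iff vec_eq_iff)
qed

section \<open>Eigenvectors and spectral projections\<close>

text \<open>The vector \<open>p(T) v\<close>.\<close>

definition poly_action :: "('a::complex_vector \<Rightarrow> 'a) \<Rightarrow> 'a \<Rightarrow> complex poly \<Rightarrow> 'a" where
  "poly_action T v p = (\<Sum>i\<le>degree p. coeff p i *\<^sub>C (T ^^ i) v)"

lemma poly_action_altdef:
  assumes "degree p \<le> n"
  shows "poly_action T v p = (\<Sum>i\<le>n. coeff p i *\<^sub>C (T ^^ i) v)"
  unfolding poly_action_def
  by (rule sum.mono_neutral_left) (use assms in \<open>auto simp: coeff_eq_0\<close>)

lemma poly_action_add: "poly_action T v (p + q) = poly_action T v p + poly_action T v q"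
proof -
  define n where "n = max (degree p) (degree q)"
  have "degree (p + q) \<le> n" "degree p \<le> n" "degree q \<le> n"
    by (auto simp: n_def degree_add_le)
  then show ?thesis by (simp add: poly_action_altdef scaleC_add_left sum.distrib)
qed

lemma poly_action_0: "poly_action T v 0 = 0"
  by (simp add: poly_action_def)

lemma poly_action_sum: "poly_action T v (sum f S) = (\<Sum>i\<in>S. poly_action T v (f i))"
  by (induction S rule: infinite_finite_induct) (simp_all add: poly_action_add poly_action_0)

lemma poly_action_smult: "poly_action T v (smult c p) = c *\<^sub>C poly_action T v p"
  by (simp add: poly_action_altdef[of "smult c p" "degree p"] poly_action_def
      complex_vector.scale_sum_right scaleC_scaleC degree_smult_le)

lemma poly_action_monom: "poly_action T v (monom c n) = c *\<^sub>C (T ^^ n) v"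
proof -
  have "poly_action T v (monom c n) = (\<Sum>i\<le>n. (if i = n then c *\<^sub>C (T ^^ i) v else 0))"
    unfolding poly_action_altdef[OF degree_monom_le] by (rule sum.cong) auto
  then show ?thesis by simp
qed

lemma poly_action_pCons:
  assumes T: "clinear T"
  shows "poly_action T v (pCons a p) = a *\<^sub>C v + T (poly_action T v p)"
proof -
  have "poly_action T v (pCons a p) = (\<Sum>i\<le>Suc (degree p). coeff (pCons a p) i *\<^sub>C (T ^^ i) v)"
    by (rule poly_action_altdef) (simp add: degree_pCons_le)
  also have "\<dots> = a *\<^sub>C v + (\<Sum>i\<le>degree p. coeff p i *\<^sub>C T ((T ^^ i) v))"
    by (simp add: sum.atMost_Suc_shift del: sum.atMost_Suc)
  finally show ?thesis
    by (simp add: poly_action_def complex_vector.linear_sum[OF T] clinear_scale[OF T])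
qed

lemma poly_action_in_span: "poly_action T v p \<in> complex_vector.span (range (\<lambda>n. (T ^^ n) v))"
  unfolding poly_action_def
  by (intro complex_vector.span_sum complex_vector.span_scale complex_vector.span_base) auto

lemma annihilating_poly_exists:
  fixes v :: "'a::complex_vector"
  assumes "finite S" and "complex_vector.span S = (UNIV :: 'a set)"
  obtains p where "p \<noteq> 0" "poly_action T v p = 0"
proof (cases "inj (\<lambda>n. (T ^^ n) v)")
  case False
  then obtain i j where ij: "i \<noteq> j" "(T ^^ i) v = (T ^^ j) v" by (auto simp: inj_def)
  let ?p = "monom 1 i + monom (-1) j :: complex poly"
  have "coeff ?p i \<noteq> 0" using ij(1) by simp
  moreover have "poly_action T v ?p = 0"
    using ij(2) by (simp add: poly_action_add poly_action_monom scaleC_one)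
  ultimately show ?thesis using that[of ?p] by (metis coeff_0)
next
  case True
  let ?R = "range (\<lambda>n. (T ^^ n) v)"
  have "infinite ?R" using True by (simp add: finite_image_iff)
  then have "complex_vector.dependent ?R"
    using complex_vector.independent_span_bound[OF assms(1), of ?R] assms(2) by auto
  then obtain t u w where t: "finite t" "t \<subseteq> ?R" "(\<Sum>w\<in>t. u w *\<^sub>C w) = 0" "w \<in> t" "u w \<noteq> 0"
    unfolding complex_vector.dependent_explicit by blast
  have "\<forall>w\<in>t. \<exists>n. w = (T ^^ n) v" using t(2) by blast
  then obtain k where k: "\<And>w. w \<in> t \<Longrightarrow> w = (T ^^ k w) v" by metis
  define p where "p = (\<Sum>w\<in>t. monom (u w) (k w))"
  have "poly_action T v p = (\<Sum>w\<in>t. u w *\<^sub>C (T ^^ k w) v)"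
    by (simp add: p_def poly_action_sum poly_action_monom)
  also have "\<dots> = (\<Sum>w\<in>t. u w *\<^sub>C w)"
    by (rule sum.cong) (simp_all flip: k)
  finally have "poly_action T v p = 0" by (simp add: t(3))
  moreover have "coeff p (k w) = (\<Sum>w'\<in>t. if w' = w then u w' else 0)"
    unfolding p_def coeff_sum coeff_monom
  proof (rule sum.cong[OF refl])
    fix w' assume "w' \<in> t"
    then have "k w' = k w \<longleftrightarrow> w' = w" using k t(4) by metis
    then show "(if k w' = k w then u w' else 0) = (if w' = w then u w' else 0)" by simp
  qed
  then have "coeff p (k w) \<noteq> 0" using t(1,4,5) by simp
  ultimately show ?thesis using that[of p] by (metis coeff_0)
qed

text \<open>Take a nonzero polynomial \<open>p\<close> of least degree with \<open>p(T) v = 0\<close> and split off a root,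
  \<open>p = (X - c) q\<close>. Then \<open>q(T) v\<close> is not zero and is an eigenvector for \<open>c\<close>. That it lies in the
  cyclic subspace of \<open>v\<close> is what the applications below need.\<close>

lemma cyclic_eigenvector_exists:
  fixes v :: "'a::complex_vector"
  assumes "finite S" and "complex_vector.span S = (UNIV :: 'a set)" and T: "clinear T" and "v \<noteq> 0"
  obtains h c where "h \<in> complex_vector.span (range (\<lambda>n. (T ^^ n) v))" "h \<noteq> 0" "T h = c *\<^sub>C h"
proof -
  define P where "P p \<longleftrightarrow> p \<noteq> 0 \<and> poly_action T v p = 0" for p
  obtain p where p: "P p" and min: "\<And>q. P q \<Longrightarrow> degree p \<le> degree q"
    using annihilating_poly_exists[OF assms(1,2), of T v]
    by (metis (no_types) P_def ex_has_least_nat[of P _ degree])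
  have "degree p > 0"
  proof (rule ccontr)
    assume "\<not> degree p > 0"
    then obtain a where a: "p = [:a:]" by (auto elim: degree_eq_zeroE)
    then have "poly_action T v p = a *\<^sub>C v" by (simp add: poly_action_def)
    then show False using p a \<open>v \<noteq> 0\<close> by (auto simp: P_def)
  qed
  then obtain c where "poly p c = 0" using alg_closed_imp_poly_has_root by blast
  then obtain q where q: "p = [:- c, 1:] * q" by (auto simp: poly_eq_0_iff_dvd)
  have "q \<noteq> 0" using p q by (auto simp: P_def)
  then have "degree q < degree p" unfolding q by (subst degree_mult_eq) auto
  then have nz: "poly_action T v q \<noteq> 0" using min \<open>q \<noteq> 0\<close> by (force simp: P_def)
  have "poly_action T v p = poly_action T v (smult (- c) q + pCons 0 q)" using q by simp
  also have "\<dots> = - (c *\<^sub>C poly_action T v q) + T (poly_action T v q)"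
    by (simp only: poly_action_add poly_action_smult poly_action_pCons[OF T]) simp
  finally have "T (poly_action T v q) = c *\<^sub>C poly_action T v q"
    using p by (simp add: P_def)
  then show ?thesis by (rule that[OF poly_action_in_span nz])
qed

text \<open>\<open>x\<close> is a linear combination of its real part (\<open>a = 1\<close>) and its imaginary part (\<open>a = \<i>\<close>), so
  not both of these self-adjoint elements can lie in \<open>V\<close>.\<close>

lemma selfadjoint_outside_subspace:
  fixes x :: "'a::star_algebra"
  assumes V: "complex_vector.subspace V" and x: "x \<notin> V"
  obtains a where "a *\<^sub>C x + cnj a *\<^sub>C star x \<notin> V"
proof (rule ccontr)
  assume "\<not> thesis"
  then have V': "a *\<^sub>C x + cnj a *\<^sub>C star x \<in> V" for a using that by blast
  have half: "(1/2) *\<^sub>C x + (1/2) *\<^sub>C x = x"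
    by (simp add: scaleC_one flip: scaleC_add_left)
  have "(1/2) *\<^sub>C (1 *\<^sub>C x + cnj 1 *\<^sub>C star x) + (- \<i> / 2) *\<^sub>C (\<i> *\<^sub>C x + cnj \<i> *\<^sub>C star x) \<in> V"
    using V' V complex_vector.subspace_add complex_vector.subspace_scale by blast
  also have "(1/2) *\<^sub>C (1 *\<^sub>C x + cnj 1 *\<^sub>C star x) + (- \<i> / 2) *\<^sub>C (\<i> *\<^sub>C x + cnj \<i> *\<^sub>C star x) = x"
    using half by (simp add: scaleC_add_right scaleC_scaleC complex_vector.scale_right_diff_distrib)
  finally show False using x by simp
qed

lemma selfadjoint_combination:
  "star (a *\<^sub>C x + cnj a *\<^sub>C star x) = a *\<^sub>C x + cnj a *\<^sub>C star (x :: 'a::star_algebra)"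
  by (simp add: star_add star_scaleC star_star add.commute)

context state
begin

lemma selfadjoint_state_real: "star x = x \<Longrightarrow> \<psi> x \<in> \<real>"
  using state_star[of x] by (simp add: Reals_cnj_iff)

text \<open>A substitute for the functional calculus. The span \<open>W\<close> of the elements \<open>t\<^sup>n u\<close> is closed under
  the involution and commutes with \<open>t\<close>, which makes the eigenvalues of \<open>t\<close> on \<open>W\<close> real and allows
  the eigenvector to be chosen self-adjoint. Multiplying it by any element of \<open>W\<close>, hence also by
  itself, amounts to multiplying it by a scalar and by \<open>u\<close>. With \<open>u = 1\<close> this gives a multiple of a
  projection, with \<open>t = u\<^sup>2\<close> an odd polynomial in \<open>u\<close> whose cube is a multiple of itself.\<close>

lemma selfadjoint_eigenelement:
  fixes t u :: 'a
  assumes fin: "finite S" "complex_vector.span S = (UNIV :: 'a set)"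
    and t: "star t = t" and u: "star u = u" "u \<noteq> 0" and comm: "t * u = u * t"
  obtains h c k where "h \<in> complex_vector.span (range (\<lambda>n. t ^ n * u))" "h \<noteq> 0" "star h = h"
    "t * h = c *\<^sub>C h" "h * h = k *\<^sub>C (u * h)"
proof -
  let ?W = "complex_vector.span (range (\<lambda>n. t ^ n * u))"
  have lin: "clinear ((*) t)"
    by (rule clinearI) (simp_all add: distrib_left scaleC_mult_right)
  have pow: "((*) t ^^ n) u = t ^ n * u" for n
    by (induction n) (simp_all add: mult.assoc)
  obtain g c where g: "g \<in> ?W" "g \<noteq> 0" "t * g = c *\<^sub>C g"
    using cyclic_eigenvector_exists[OF fin lin u(2)] unfolding pow by blast
  have comm_pow: "t ^ n * u = u * t ^ n" for n
    by (induction n) (simp_all add: mult.assoc, simp add: comm flip: mult.assoc)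
  have W_comm: "t * w = w * t" if "w \<in> ?W" for w
    using that
  proof (induction w rule: complex_vector.span_induct_alt)
    case (step c w y)
    then obtain n where "w = t ^ n * u" by auto
    then have "t * w = w * t"
      by (simp add: mult.assoc comm[symmetric])
        (simp add: power_commutes flip: mult.assoc)
    then show ?case using step
      by (simp add: distrib_left distrib_right scaleC_mult_left scaleC_mult_right)
  qed simp
  have W_star: "star w \<in> ?W" if "w \<in> ?W" for w
    using that
  proof (induction w rule: complex_vector.span_induct_alt)
    case base
    show ?case by (simp add: complex_vector.span_zero)
  next
    case (step c w y)
    then obtain n where "w = t ^ n * u" by auto
    then have "star w = w" by (simp add: star_mult star_power t u comm_pow)
    then show ?case using step
      by (simp add: star_add star_scaleC complex_vector.span_add complex_vector.span_scale
          complex_vector.span_base)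
  qed
  have "c * \<psi> (star g * g) = \<psi> (star g * t * g)"
    by (simp add: mult.assoc g(3) scaleC_mult_right)
  also have "\<dots> \<in> \<real>"
    by (rule selfadjoint_state_real) (simp add: star_mult star_star t mult.assoc)
  finally have "c * \<psi> (star g * g) \<in> \<real>" .
  moreover have "\<psi> (star g * g) \<in> \<real>" "\<psi> (star g * g) \<noteq> 0"
    using g(2) definite by (auto intro: selfadjoint_state_real simp: star_mult star_star)
  ultimately have c: "cnj c = c"
    by (metis Reals_cnj_iff complex_cnj_mult mult_cancel_right)
  have star_g: "t * star g = c *\<^sub>C star g"
  proof -
    have "t * star g = star (t * g)"
      using W_comm[OF W_star[OF g(1)]] by (simp add: star_mult t)
    then show ?thesis by (simp add: g(3) star_scaleC c)
  qed
  obtain a where a: "a *\<^sub>C g + cnj a *\<^sub>C star g \<notin> {0}"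
    using selfadjoint_outside_subspace[of "{0}" g] g(2) complex_vector.subspace_0 by auto
  define h where "h = a *\<^sub>C g + cnj a *\<^sub>C star g"
  have h: "h \<in> ?W" "h \<noteq> 0" "star h = h" "t * h = c *\<^sub>C h"
    using a g(1) W_star[OF g(1)]
    by (simp_all add: h_def selfadjoint_combination complex_vector.span_add
        complex_vector.span_scale distrib_left scaleC_mult_right g(3) star_g scaleC_add_right
        scaleC_scaleC mult.commute)
  have pow_h: "t ^ n * h = c ^ n *\<^sub>C h" for n
    by (induction n) (simp_all add: scaleC_one mult.assoc scaleC_mult_right h(4) scaleC_scaleC mult.commute)
  have "\<exists>k. w * h = k *\<^sub>C (u * h)" if "w \<in> ?W" for w
    using that
  proof (induction w rule: complex_vector.span_induct_alt)
    case base
    show ?case by (intro exI[of _ 0]) simp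
  next
    case (step a w y)
    then obtain n k where "w = t ^ n * u" "y * h = k *\<^sub>C (u * h)" by auto
    then have "(a *\<^sub>C w + y) * h = (a * c ^ n + k) *\<^sub>C (u * h)"
      by (simp add: comm_pow mult.assoc pow_h distrib_right scaleC_mult_left scaleC_mult_right
          scaleC_add_left scaleC_scaleC)
    then show ?case by blast
  qed
  then obtain k where "h * h = k *\<^sub>C (u * h)" using h(1) by blast
  then show ?thesis using that h by blast
qed

text \<open>Multiplying by \<open>h\<close> once more shows that \<open>c\<close> is the quotient of \<open>\<psi>(h\<^sup>4)\<close> by \<open>\<psi>(h\<^sup>2)\<close>, both of
  which are positive.\<close>

lemma selfadjoint_cube_eigenvalue:
  fixes h :: 'a
  assumes h: "star h = h" "h \<noteq> 0" and cube: "h * (h * h) = c *\<^sub>C h"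
  obtains r :: real where "r > 0" "c = complex_of_real (r * r)"
proof -
  have sq: "\<psi> (h * h) \<noteq> 0" "\<psi> (h * h) \<in> \<real>\<^sub>\<ge>\<^sub>0"
    using definite[of h] positive[of h] h by auto
  then have "h * h \<noteq> 0" by auto
  then have sq_sq: "\<psi> (h * h * (h * h)) \<noteq> 0" "\<psi> (h * h * (h * h)) \<in> \<real>\<^sub>\<ge>\<^sub>0"
    using definite[of "h * h"] positive[of "h * h"] h by (auto simp: star_mult)
  have "h * h * (h * h) = c *\<^sub>C (h * h)" by (simp add: mult.assoc cube scaleC_mult_right)
  then have "\<psi> (h * h * (h * h)) = c * \<psi> (h * h)" by simp
  then have c: "c = \<psi> (h * h * (h * h)) / \<psi> (h * h)" using sq(1) by simp
  then have "c \<in> \<real>\<^sub>\<ge>\<^sub>0" "c \<noteq> 0" using sq sq_sq by (simp_all add: nonneg_Reals_divide_I)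
  then obtain a where "c = complex_of_real a" "a > 0"
    by (metis nonneg_Reals_cases of_real_eq_0_iff order_le_less)
  then show ?thesis using that[of "sqrt a"] by simp
qed

end


section \<open>Dimension and spectrum\<close>

lemma fd_basis_exists:
  obtains S :: "'b::fd_cstar_algebra set"
  where "finite S" "complex_vector.independent S" "complex_vector.span S = UNIV"
proof -
  obtain S where S: "finite S" "\<And>x :: 'b. \<exists>c. x = (\<Sum>v\<in>S. c v *\<^sub>C v)"
    using finite_dimensional by blast
  have "x \<in> complex_vector.span S" for x
  proof -
    obtain c where "x = (\<Sum>v\<in>S. c v *\<^sub>C v)" using S(2) by blast
    then show ?thesis
      by (auto intro: complex_vector.span_sum complex_vector.span_scale complex_vector.span_base)
  qed
  then have span: "complex_vector.span S = UNIV" by blast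
  obtain T where T: "T \<subseteq> S" "complex_vector.independent T" "S \<subseteq> complex_vector.span T"
    using complex_vector.maximal_independent_subset by blast
  have "complex_vector.span T = UNIV"
    using complex_vector.span_minimal[OF T(3) complex_vector.subspace_span] span by blast
  then show ?thesis using that T(1,2) S(1) finite_subset by blast
qed

lemma dim_ge_2_iff:
  "complex_vector.dim (UNIV :: 'b::fd_cstar_algebra set) \<ge> 2 \<longleftrightarrow>
    (\<exists>x :: 'b. x \<notin> complex_vector.span {1})"
proof
  assume dim: "complex_vector.dim (UNIV :: 'b set) \<ge> 2"
  show "\<exists>x :: 'b. x \<notin> complex_vector.span {1}"
  proof (rule ccontr)
    assume "\<not> ?thesis"
    then have "(UNIV :: 'b set) \<subseteq> complex_vector.span {1}" by blast
    from complex_vector.dim_le_card[OF this] dim show False by simp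
  qed
next
  assume "\<exists>x :: 'b. x \<notin> complex_vector.span {1}"
  then obtain x :: 'b where x: "x \<notin> complex_vector.span {1}" by blast
  obtain S :: "'b set" where S: "finite S" "complex_vector.independent S"
    "complex_vector.span S = UNIV" by (rule fd_basis_exists)
  have "complex_vector.independent {x, 1}"
    using x complex_vector.independent_insertI[of x "{1}"] by simp
  moreover have "x \<noteq> 1" using x complex_vector.span_base[of 1 "{1}"] by auto
  ultimately have "2 \<le> card S"
    using complex_vector.independent_span_bound[OF S(1), of "{x, 1}"] S(3) by simp
  moreover have "complex_vector.dim (UNIV :: 'b set) = card S"
    using complex_vector.dim_span_eq_card_independent[OF S(2)] S(3) by simp
  ultimately show "complex_vector.dim (UNIV :: 'b set) \<ge> 2" by simp
qed

text \<open>Injective endomorphisms of a finite-dimensional space are bijective.\<close>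

lemma spectrum_iff_eigenvector:
  fixes T :: "'b::fd_cstar_algebra \<Rightarrow> 'b"
  assumes T: "clinear T"
  shows "c \<in> spectrum T \<longleftrightarrow> (\<exists>x. x \<noteq> 0 \<and> T x = c *\<^sub>C x)"
proof -
  let ?g = "\<lambda>x. T x - c *\<^sub>C x"
  have g: "clinear ?g"
    by (rule clinearI) (simp_all add: clinear_add[OF T] clinear_scale[OF T] scaleC_add_right
        complex_vector.scale_right_diff_distrib scaleC_scaleC mult.commute)
  obtain S :: "'b set" where S: "finite S" "complex_vector.independent S"
    "complex_vector.span S = UNIV" by (rule fd_basis_exists)
  interpret fd: finite_dimensional_vector_space "scaleC :: complex \<Rightarrow> 'b \<Rightarrow> 'b" S
    by unfold_locales (use S in auto)
  have "bij ?g \<longleftrightarrow> inj ?g"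
    using fd.linear_inj_imp_surj[OF g] by (auto simp: bij_def)
  also have "\<dots> \<longleftrightarrow> (\<forall>x. ?g x = 0 \<longrightarrow> x = 0)"
    by (rule complex_vector.linear_inj_iff_eq_0[OF g])
  finally show ?thesis by (auto simp: spectrum_def)
qed

section \<open>Regular quantum graphs\<close>

text \<open>The hypotheses on the graph in the form in which they are used: self-adjointness as an identity
  of inner products, so that no adjoint of \<open>A\<close> occurs, and an orthonormal basis \<open>E\<close> at hand.\<close>

locale regular_tracial_graph = traced_algebra \<psi> E
  for \<psi> :: "'b::fd_cstar_algebra \<Rightarrow> complex" and E +
  fixes A :: "'b \<Rightarrow> 'b" and d :: complex
  assumes clinear_A: "clinear A"
    and A_star: "A (star x) = star (A x)"
    and A_selfadjoint: "L2_inner \<psi> (A x) y = L2_inner \<psi> x (A y)"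
    and A_schur: "schur \<psi> A A = A"
    and A_1: "A 1 = d *\<^sub>C 1"
begin

lemmas A_simps = clinear_add[OF clinear_A] clinear_scale[OF clinear_A] clinear_0[OF clinear_A]
  complex_vector.linear_diff[OF clinear_A] complex_vector.linear_neg[OF clinear_A]

text \<open>Complete positivity in the style of Kraus or Stinespring, with
  \<open>C\<^sub>e(x) = \<delta>\<^sup>-\<^sup>1 A(e\<^sup>* x)\<close>: by reality, the adjoint of \<open>A(e\<^sup>* x)\<close> is the factor
  \<open>A(x\<^sup>* e)\<close> that the Schur product provides.\<close>

lemma kraus_family_exists:
  obtains C where "\<And>x y. A (star x * y) = (\<Sum>e\<in>E. star (C e x) * C e y)"
proof
  define r where "r = sqrt (inverse ((delta \<psi>)\<^sup>2))"
  have r: "complex_of_real r * complex_of_real r = complex_of_real (inverse ((delta \<psi>)\<^sup>2))"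
    unfolding r_def of_real_mult[symmetric] by (subst real_sqrt_mult_self) simp
  fix x y
  have "A (star x * y) = schur \<psi> A A (star x * y)" by (simp add: A_schur)
  also have "\<dots> = (\<Sum>e\<in>E. (complex_of_real r * complex_of_real r) *\<^sub>C (A (star x * e) * A (star e * y)))"
    unfolding schur_mult[OF clinear_A clinear_A] r by (rule complex_vector.scale_sum_right)
  also have "\<dots> = (\<Sum>e\<in>E. star (complex_of_real r *\<^sub>C A (star e * x)) * (complex_of_real r *\<^sub>C A (star e * y)))"
    by (simp add: star_scaleC A_star[symmetric] star_mult star_star scaleC_mult_left
        scaleC_mult_right scaleC_scaleC)
  finally show "A (star x * y) =
    (\<Sum>e\<in>E. star (complex_of_real r *\<^sub>C A (star e * x)) * (complex_of_real r *\<^sub>C A (star e * y)))" .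
qed

lemma degree_real: "cnj d = d"
  using A_selfadjoint[of 1 1] by (simp add: A_1 L2_inner_def star_scaleC scaleC_mult_left)

lemma state_A: "\<psi> (A x) = d * \<psi> x"
  using A_selfadjoint[of 1 x] by (simp add: A_1 L2_inner_simps degree_real) (simp add: L2_inner_def)

text \<open>\<open>A 1 = 0\<close> forces \<open>C\<^sub>e(1) = 0\<close>, and \<open>A y = \<Sum>\<^sub>e C\<^sub>e(1)\<^sup>* C\<^sub>e(y)\<close>.\<close>

lemma degree_0_imp_A_0:
  assumes "d = 0"
  shows "A y = 0"
proof -
  obtain C where C: "\<And>x y. A (star x * y) = (\<Sum>e\<in>E. star (C e x) * C e y)"
    using kraus_family_exists by blast
  have "(\<Sum>e\<in>E. \<psi> (star (C e 1) * C e 1)) = \<psi> (A (star 1 * 1))"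
    unfolding C by simp
  also have "\<dots> = 0" by (simp add: A_1 assms)
  finally have sum_0: "(\<Sum>e\<in>E. \<psi> (star (C e 1) * C e 1)) = 0" .
  have "C e 1 = 0" if "e \<in> E" for e
    by (rule sum_squares_eq_0[OF finite_basis sum_0 that])
  then show ?thesis using C[of 1 y] by simp
qed

text \<open>Projecting \<open>C\<^sub>e(y)\<close> away from the vector \<open>(C\<^sub>e(1))\<^sub>e\<close> gives, up to the factor \<open>d\<close>, the elements
  \<open>D\<^sub>e(y)\<close> below, and \<open>\<Sum>\<^sub>e D\<^sub>e(z)\<^sup>* D\<^sub>e(w)\<close> is proportional to the defect of
  multiplicativity of \<open>A / d\<close>. If its trace vanishes at \<open>z = w = x\<close>, faithfulness gives \<open>D\<^sub>e(x) = 0\<close> for all \<open>e\<close>, so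
  the defect vanishes at \<open>z = x\<close> and arbitrary \<open>w\<close>.\<close>

lemma kadison_schwarz_equality:
  assumes "d \<noteq> 0" and eq: "d * \<psi> (A (star x * x)) = \<psi> (star (A x) * A x)"
  shows "d *\<^sub>C A (star x * y) = star (A x) * A y"
proof -
  obtain C where C: "\<And>x y. A (star x * y) = (\<Sum>e\<in>E. star (C e x) * C e y)"
    using kraus_family_exists by blast
  define D where "D e y = d *\<^sub>C C e y - C e 1 * A y" for e y
  have DD: "(\<Sum>e\<in>E. star (D e z) * D e w) = d *\<^sub>C (d *\<^sub>C A (star z * w) - star (A z) * A w)" for z w
  proof -
    have "(\<Sum>e\<in>E. star (D e z) * D e w) =
      (\<Sum>e\<in>E. (d * d) *\<^sub>C (star (C e z) * C e w) - d *\<^sub>C ((star (C e z) * C e 1) * A w)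
        - d *\<^sub>C (star (A z) * (star (C e 1) * C e w)) + star (A z) * (star (C e 1) * C e 1) * A w)"
      by (rule sum.cong) (simp_all add: D_def star_diff star_scaleC star_mult degree_real
          right_diff_distrib left_diff_distrib scaleC_mult_left scaleC_mult_right scaleC_scaleC mult.assoc
          complex_vector.scale_right_diff_distrib)
    also have "\<dots> = (d * d) *\<^sub>C A (star z * w) - d *\<^sub>C (A (star z * 1) * A w)
        - d *\<^sub>C (star (A z) * A (star 1 * w)) + star (A z) * A (star 1 * 1) * A w"
      unfolding C
      by (simp add: sum.distrib sum_subtractf sum_distrib_left sum_distrib_right
          complex_vector.scale_sum_right)
    also have "\<dots> = d *\<^sub>C (d *\<^sub>C A (star z * w) - star (A z) * A w)"
      by (simp add: A_1 A_star scaleC_mult_left scaleC_mult_right scaleC_scaleC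
          complex_vector.scale_right_diff_distrib)
    finally show ?thesis .
  qed
  have "(\<Sum>e\<in>E. \<psi> (star (D e x) * D e x)) = \<psi> (\<Sum>e\<in>E. star (D e x) * D e x)" by simp
  also have "\<dots> = 0" unfolding DD by (simp add: eq)
  finally have sum_0: "(\<Sum>e\<in>E. \<psi> (star (D e x) * D e x)) = 0" .
  have "D e x = 0" if "e \<in> E" for e
    by (rule sum_squares_eq_0[OF finite_basis sum_0 that])
  then have "d *\<^sub>C (d *\<^sub>C A (star x * y) - star (A x) * A y) = 0"
    unfolding DD[symmetric] by simp
  then show ?thesis using \<open>d \<noteq> 0\<close> by simp
qed

text \<open>Here \<open>\<psi> \<circ> A = d \<psi>\<close> makes both sides of the Kadison-Schwarz inequality agree.\<close>

lemma A_mult_extremal_eigenelement: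
  assumes "d \<noteq> 0" and x: "star x = x" "A x = - (d *\<^sub>C x)"
  shows "A (x * y) = - (x * A y)"
proof -
  have "d * \<psi> (A (star x * x)) = \<psi> (star (A x) * A x)"
    by (simp add: state_A x star_minus star_scaleC degree_real scaleC_mult_left scaleC_mult_right)
  from kadison_schwarz_equality[OF \<open>d \<noteq> 0\<close> this, of y]
  have "d *\<^sub>C A (x * y) = d *\<^sub>C (- (x * A y))"
    by (simp add: x star_minus star_scaleC degree_real scaleC_mult_left)
  then show ?thesis by (rule complex_vector.scale_left_imp_eq[OF \<open>d \<noteq> 0\<close>])
qed

text \<open>The number \<open>\<psi>(q A(p))\<close> is the sum of the \<open>\<psi>((C\<^sub>e(p) q)\<^sup>* (C\<^sub>e(p) q))\<close>, so
  if it vanishes, then every \<open>C\<^sub>e(p) q\<close> does.\<close>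

lemma orthogonal_imp_mult_0:
  assumes p: "star p = p" "p * p = p" and q: "star q = q" "q * q = q"
    and orth: "\<psi> (q * A p) = 0"
  shows "A p * q = 0"
proof -
  obtain C where C: "\<And>x y. A (star x * y) = (\<Sum>e\<in>E. star (C e x) * C e y)"
    using kraus_family_exists by blast
  have Ap: "A p = (\<Sum>e\<in>E. star (C e p) * C e p)" using C[of p p] p by simp
  have "(\<Sum>e\<in>E. \<psi> (star (C e p * q) * (C e p * q))) = \<psi> (q * A p * q)"
    by (simp add: Ap star_mult q sum_distrib_left sum_distrib_right mult.assoc)
  also have "\<dots> = \<psi> (q * A p)"
    using trace[of "q * A p" q] q(2) by (simp flip: mult.assoc)
  finally have sum_0: "(\<Sum>e\<in>E. \<psi> (star (C e p * q) * (C e p * q))) = 0"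
    using orth by (rule trans)
  have "C e p * q = 0" if "e \<in> E" for e
    by (rule sum_squares_eq_0[OF finite_basis sum_0 that])
  then show ?thesis by (simp add: Ap sum_distrib_right mult.assoc)
qed

text \<open>The projections are the images of the two vertices of \<open>K\<^sub>2\<close>; the loop \<open>T\<^sub>1\<close> receives the
  complement \<open>1 - p - q\<close>, which may be zero and is automatically multiplied by \<open>d\<close>.\<close>

lemma has_bipartite_component_iff:
  "has_bipartite_component \<psi> A \<longleftrightarrow>
    (\<exists>p q. star p = p \<and> p * p = p \<and> p \<noteq> 0 \<and> star q = q \<and> q * q = q \<and> q \<noteq> 0 \<and> p * q = 0 \<and>
      A p = d *\<^sub>C q \<and> A q = d *\<^sub>C p)"
proof -
  \<comment> \<open>The matrix entries of \<open>f\<^sup>\<dagger> A f\<close>; the factor 3 undoes the weight \<open>1/3\<close> of a point mass.\<close>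
  have compressed: "clinear (L2_adjoint tau3 \<psi> f \<circ> A \<circ> f)"
    "(L2_adjoint tau3 \<psi> f \<circ> A \<circ> f) (axis i 1) $ k = 3 * \<psi> (star (f (axis k 1)) * A (f (axis i 1)))"
    if f: "clinear f" for f i k
  proof -
    show "clinear (L2_adjoint tau3 \<psi> f \<circ> A \<circ> f)"
      using tau3.clinear_L2_adjoint[OF faithful f]
      by (intro clinearI) (simp_all add: clinear_add[OF f] clinear_scale[OF f] A_simps
          clinear_add clinear_scale)
    have "L2_inner tau3 (axis k 1) (L2_adjoint tau3 \<psi> f (A (f (axis i 1)))) =
        \<psi> (star (f (axis k 1)) * A (f (axis i 1)))"
      unfolding tau3.L2_adjoint_inner[OF faithful f, symmetric] by (simp add: L2_inner_def)
    moreover have "L2_inner tau3 (axis k 1) v = v $ k / 3" for v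
      by (simp add: tau3_inner axis_def if_distrib[of "\<lambda>z. z * _"] if_distrib[of cnj] cong: if_cong)
    ultimately show "(L2_adjoint tau3 \<psi> f \<circ> A \<circ> f) (axis i 1) $ k =
        3 * \<psi> (star (f (axis k 1)) * A (f (axis i 1)))" by simp
  qed
  show ?thesis
  proof
    assume "has_bipartite_component \<psi> A"
    then obtain f where f: "clinear f" "\<And>x y. f (x * y) = f x * f y" "\<And>x. f (star x) = star (f x)"
      "f 1 = 1" and inj: "inj_on f {v. v $ 3 = 0}"
      and fixed: "schur tau3 ((*v) K2_T1_adjacency) (L2_adjoint tau3 \<psi> f \<circ> A \<circ> f) =
        L2_adjoint tau3 \<psi> f \<circ> A \<circ> f"
      by (auto simp: has_bipartite_component_def unital_star_hom_def Let_def)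
    define P where "P i = f (axis i 1)" for i
    have star_P: "star (P i) = P i" for i
    proof -
      have "star (axis i 1 :: complex ^ 3) = axis i 1" by (simp add: vec_eq_iff axis_def)
      then show ?thesis by (simp add: P_def flip: f(3))
    qed
    have P_mult: "P i * P j = (if i = j then P i else 0)" for i j
    proof -
      have "axis i 1 * axis j 1 = (if i = j then axis i 1 else (0 :: complex ^ 3))"
        by (auto simp: vec_eq_iff axis_def)
      then show ?thesis by (simp add: P_def clinear_0[OF f(1)] flip: f(2))
    qed
    have "axis 1 1 + axis 2 1 + axis 3 1 = (1 :: complex ^ 3)"
      by (simp add: vec_eq_iff forall_3 axis_def)
    then have P_sum: "P 1 + P 2 + P 3 = 1" by (simp add: P_def f(4) flip: clinear_add[OF f(1)])
    have "P i \<noteq> 0" if "i \<noteq> 3" for i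
    proof
      assume "P i = 0"
      then have "f (axis i 1) = f 0" by (simp add: P_def clinear_0[OF f(1)])
      moreover have "(axis i 1 :: complex ^ 3) $ 3 = 0" using that by (simp add: axis_def)
      ultimately have "axis i 1 = (0 :: complex ^ 3)" by (intro inj_onD[OF inj]) simp_all
      then show False by (simp add: axis_eq_0_iff)
    qed
    then have P_nz: "P 1 \<noteq> 0" "P 2 \<noteq> 0" by simp_all
    have vanish: "A (P i) * P k = 0" if "K2_T1_adjacency $ k $ i = 0" for i k
    proof (rule orthogonal_imp_mult_0)
      show "\<psi> (P k * A (P i)) = 0"
        using fixed that compressed(2)[OF f(1), of i k]
        unfolding schur_K2_T1_fixed_iff[OF compressed(1)[OF f(1)]]
        by (simp add: star_P flip: P_def)
    qed (simp_all add: star_P P_mult)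
    have K: "A (P 1) * P 1 = 0" "A (P 2) * P 2 = 0" "A (P 1) * P 3 = 0" "A (P 2) * P 3 = 0"
      "A (P 3) * P 1 = 0" "A (P 3) * P 2 = 0"
      by (simp_all add: vanish K2_T1_adjacency_def)
    have d_P: "d *\<^sub>C P k = A (P 1) * P k + A (P 2) * P k + A (P 3) * P k" for k
    proof -
      have "d *\<^sub>C P k = A (P 1 + P 2 + P 3) * P k" by (simp add: P_sum A_1 scaleC_mult_left)
      then show ?thesis by (simp add: A_simps distrib_right)
    qed
    have A_P: "A (P i) = A (P i) * P 1 + A (P i) * P 2 + A (P i) * P 3" for i
      by (simp add: P_sum flip: distrib_left)
    have "A (P 1) = d *\<^sub>C P 2" "A (P 2) = d *\<^sub>C P 1"
      using A_P[of 1] A_P[of 2] d_P[of 1] d_P[of 2] K by simp_all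
    then show "\<exists>p q. star p = p \<and> p * p = p \<and> p \<noteq> 0 \<and> star q = q \<and> q * q = q \<and> q \<noteq> 0 \<and>
        p * q = 0 \<and> A p = d *\<^sub>C q \<and> A q = d *\<^sub>C p"
      using P_nz by (intro exI[of _ "P 1"] exI[of _ "P 2"]) (simp add: star_P P_mult)
  next
    assume "\<exists>p q. star p = p \<and> p * p = p \<and> p \<noteq> 0 \<and> star q = q \<and> q * q = q \<and> q \<noteq> 0 \<and>
        p * q = 0 \<and> A p = d *\<^sub>C q \<and> A q = d *\<^sub>C p"
    then obtain p q where p: "star p = p" "p * p = p" "p \<noteq> 0"
      and q: "star q = q" "q * q = q" "q \<noteq> 0" and pq: "p * q = 0"
      and A_p: "A p = d *\<^sub>C q" and A_q: "A q = d *\<^sub>C p" by blast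
    have qp: "q * p = 0" using arg_cong[OF pq, of star] by (simp add: star_mult p q)
    define r where "r = 1 - p - q"
    have r: "star r = r" "r * r = r" "p * r = 0" "r * p = 0" "q * r = 0" "r * q = 0"
      by (simp_all add: r_def star_diff p q pq qp right_diff_distrib left_diff_distrib)
    have A_r: "A r = d *\<^sub>C r"
      by (simp add: r_def A_simps A_1 A_p A_q complex_vector.scale_right_diff_distrib)
    define f where "f v = (v $ 1) *\<^sub>C p + (v $ 2) *\<^sub>C q + (v $ 3) *\<^sub>C r" for v :: "complex ^ 3"
    have f_lin: "clinear f"
      by (rule clinearI)
        (simp_all add: f_def scaleC_add_left scaleC_add_right scaleC_scaleC algebra_simps)
    have hom: "unital_star_hom f"
      unfolding unital_star_hom_def
    proof (intro conjI allI)
      show "clinear f" by (rule f_lin)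
      show "f (x * y) = f x * f y" for x y
        by (simp add: f_def distrib_left distrib_right scaleC_mult_left scaleC_mult_right
            scaleC_scaleC p q pq qp r mult.commute)
      show "f (star x) = star (f x)" for x
        by (simp add: f_def star_add star_scaleC p q r)
      show "f 1 = 1" by (simp add: f_def scaleC_one) (simp add: r_def)
    qed
    have inj: "inj_on f {v. v $ 3 = 0}"
    proof (rule inj_onI)
      fix v w assume vw: "v \<in> {v. v $ 3 = 0}" "w \<in> {v. v $ 3 = 0}" "f v = f w"
      then have "f v * p = f w * p" "f v * q = f w * q" by simp_all
      then have "(v $ 1) *\<^sub>C p = (w $ 1) *\<^sub>C p" "(v $ 2) *\<^sub>C q = (w $ 2) *\<^sub>C q"
        by (simp_all add: f_def distrib_right scaleC_mult_left p q pq qp r)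
      then show "v = w" using p(3) q(3) vw by (simp add: vec_eq_iff forall_3)
    qed
    have f_axis: "f (axis 1 1) = p" "f (axis 2 1) = q" "f (axis 3 1) = r"
      by (simp_all add: f_def axis_def scaleC_one)
    have "\<psi> (star (f (axis k 1)) * A (f (axis i 1))) = 0" if "K2_T1_adjacency $ k $ i = 0" for k i
      using that exhaust_3[of k] exhaust_3[of i]
      by (auto simp: K2_T1_adjacency_def f_axis p q r A_p A_q A_r scaleC_mult_right pq qp)
    then have "schur tau3 ((*v) K2_T1_adjacency) (L2_adjoint tau3 \<psi> f \<circ> A \<circ> f) =
        L2_adjoint tau3 \<psi> f \<circ> A \<circ> f"
      unfolding schur_K2_T1_fixed_iff[OF compressed(1)[OF f_lin]] compressed(2)[OF f_lin] by simp
    then show "has_bipartite_component \<psi> A"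
      unfolding has_bipartite_component_def Let_def using hom inj by blast
  qed
qed

text \<open>The powers \<open>y\<^sup>2\<^sup>n\<^sup>+\<^sup>1\<close> of a self-adjoint eigenvector \<open>y\<close> are again eigenvectors for \<open>-d\<close>, so
  the same holds for the element \<open>h\<close> of their span with \<open>h\<^sup>3\<close> proportional to \<open>h\<close>; its square is an
  eigenvector for \<open>d\<close>.\<close>

lemma extremal_eigenvector_imp_bipartite:
  assumes d: "d \<noteq> 0" and x: "x \<noteq> 0" "A x = - (d *\<^sub>C x)"
  shows "has_bipartite_component \<psi> A"
proof -
  obtain a where a: "a *\<^sub>C x + cnj a *\<^sub>C star x \<notin> {0}"
    using selfadjoint_outside_subspace[of "{0}" x] x(1) complex_vector.subspace_0 by auto
  define y where "y = a *\<^sub>C x + cnj a *\<^sub>C star x"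
  have y: "star y = y" "y \<noteq> 0" "A y = - (d *\<^sub>C y)"
    using a by (simp_all add: y_def selfadjoint_combination A_simps A_star x(2) star_minus
        star_scaleC degree_real scaleC_add_right scaleC_scaleC mult.commute)
  note A_y = A_mult_extremal_eigenelement[OF d y(1) y(3)]
  obtain S :: "'b set" where S: "finite S" "complex_vector.span S = UNIV" by (rule fd_basis_exists)
  have yy: "star (y * y) = y * y" "y * y * y = y * (y * y)"
    by (simp_all add: star_mult y(1) mult.assoc)
  obtain h c k where h: "h \<in> complex_vector.span (range (\<lambda>n. (y * y) ^ n * y))" "h \<noteq> 0" "star h = h"
    "y * y * h = c *\<^sub>C h" "h * h = k *\<^sub>C (y * h)"
    by (rule selfadjoint_eigenelement[OF S yy(1) y(1,2) yy(2)])
  have A_pow: "A ((y * y) ^ n * y) = - (d *\<^sub>C ((y * y) ^ n * y))" for n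
    by (induction n) (simp_all add: y(3) mult.assoc A_y scaleC_mult_right)
  have A_h: "A h = - (d *\<^sub>C h)"
    using h(1)
  proof (induction h rule: complex_vector.span_induct_alt)
    case base
    show ?case by (simp add: A_simps)
  next
    case (step b w z)
    then obtain n where "w = (y * y) ^ n * y" by auto
    then have "A w = - (d *\<^sub>C w)" using A_pow by simp
    then show ?case
      using step by (simp add: A_simps scaleC_add_right scaleC_scaleC mult.commute)
  qed
  have A_hh: "A (h * h) = d *\<^sub>C (h * h)"
    by (simp add: h(5) A_simps A_y A_h scaleC_mult_right scaleC_scaleC mult.commute)
  have "h * (h * h) = k *\<^sub>C (y * (h * h))"
    using arg_cong[OF h(5), of "\<lambda>z. z * h"] by (simp add: scaleC_mult_left mult.assoc)
  also have "\<dots> = (k * k * c) *\<^sub>C h"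
    unfolding h(5) using h(4) by (simp add: scaleC_mult_right scaleC_scaleC mult.assoc)
  finally have cube: "h * (h * h) = (k * k * c) *\<^sub>C h" .
  then obtain r :: real where r: "r > 0" "k * k * c = complex_of_real (r * r)"
    using selfadjoint_cube_eigenvalue[OF h(3,2)] by blast
  define s where "s = complex_of_real (1 / r) *\<^sub>C h"
  have s: "star s = s" "s \<noteq> 0" "A s = - (d *\<^sub>C s)" "A (s * s) = d *\<^sub>C (s * s)"
    using r(1) h(2,3) A_h A_hh
    by (simp_all add: s_def star_scaleC A_simps scaleC_scaleC scaleC_mult_left scaleC_mult_right mult.commute)
  have s3: "s * (s * s) = s"
    using r(1) by (simp add: s_def scaleC_mult_left scaleC_mult_right scaleC_scaleC cube r(2))
  then have s4: "s * (s * (s * z)) = s * z" for z by (metis mult.assoc)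
  define P Q where "P = s * s + s" and "Q = s * s - s"
  have star: "star P = P" "star Q = Q" by (simp_all add: P_def Q_def star_add star_diff star_mult s(1))
  have two: "v + v = 2 *\<^sub>C v" for v :: 'b
    using scaleC_add_left[of 1 1 v] by (simp add: scaleC_one)
  have "P * P = P + P" "Q * Q = Q + Q" and PQ: "P * Q = 0"
    by (simp_all add: P_def Q_def distrib_left distrib_right right_diff_distrib left_diff_distrib
        mult.assoc s3 s4)
  then have sq: "P * P = 2 *\<^sub>C P" "Q * Q = 2 *\<^sub>C Q" by (simp_all add: two)
  have A_PQ: "A P = d *\<^sub>C Q" "A Q = d *\<^sub>C P"
    by (simp_all add: P_def Q_def A_simps s complex_vector.scale_right_diff_distrib scaleC_add_right)
  have "P = 0 \<longleftrightarrow> Q = 0"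
    using A_PQ d by (metis A_simps(3) complex_vector.scale_eq_0_iff)
  moreover have "P - Q = 2 *\<^sub>C s" by (simp add: P_def Q_def two)
  ultimately have nz: "P \<noteq> 0" "Q \<noteq> 0" using s(2) by auto
  show ?thesis
    unfolding has_bipartite_component_iff
    by (intro exI[of _ "(1/2) *\<^sub>C P"] exI[of _ "(1/2) *\<^sub>C Q"])
      (simp add: star_scaleC star nz scaleC_mult_left scaleC_mult_right scaleC_scaleC sq PQ
        A_simps A_PQ mult.commute)
qed

text \<open>For \<open>A = 0\<close> every projection other than \<open>0\<close> and \<open>1\<close> yields a bipartite component.\<close>

lemma nonscalar_imp_bipartite:
  fixes x :: 'b
  assumes d: "d = 0" and x: "x \<notin> complex_vector.span {1}"
  shows "has_bipartite_component \<psi> A"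
proof -
  obtain a where a: "a *\<^sub>C x + cnj a *\<^sub>C star x \<notin> complex_vector.span {1}"
    using selfadjoint_outside_subspace[OF complex_vector.subspace_span x] .
  define y where "y = a *\<^sub>C x + cnj a *\<^sub>C star x"
  have y: "star y = y" "y \<notin> complex_vector.span {1}"
    using a by (simp_all add: y_def selfadjoint_combination)
  obtain S :: "'b set" where S: "finite S" "complex_vector.span S = UNIV" by (rule fd_basis_exists)
  have comm: "y * 1 = 1 * y" by simp
  obtain h c k where h: "h \<noteq> 0" "star h = h" "y * h = c *\<^sub>C h" "h * h = k *\<^sub>C h"
    by (rule selfadjoint_eigenelement[OF S y(1) star_1 one_neq_zero comm]) auto
  have "h * h \<noteq> 0" using definite[of h] h(1,2) by force
  then have k: "k \<noteq> 0" using h(4) by auto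
  have "h * h = cnj k *\<^sub>C h"
    using arg_cong[OF h(4), of star] by (simp add: star_mult h(2) star_scaleC)
  then have "k *\<^sub>C h = cnj k *\<^sub>C h" unfolding h(4) .
  then have k_real: "k = cnj k" using h(1) by simp
  define p where "p = (1 / k) *\<^sub>C h"
  have p: "star p = p" "p * p = p" "p \<noteq> 0"
    using h(1) k by (simp_all add: p_def star_scaleC h(2) k_real[symmetric] scaleC_mult_left scaleC_mult_right h(4) scaleC_scaleC)
  have "p \<noteq> 1"
  proof
    assume "p = 1"
    have "y * p = c *\<^sub>C p" by (simp add: p_def scaleC_mult_right h(3) scaleC_scaleC mult.commute)
    then have "y = c *\<^sub>C 1" using \<open>p = 1\<close> by simp
    then show False
      using y(2) complex_vector.span_scale[OF complex_vector.span_base[of 1 "{1}"]] by auto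
  qed
  then show ?thesis
    unfolding has_bipartite_component_iff
    by (intro exI[of _ p] exI[of _ "1 - p"])
      (simp add: p d degree_0_imp_A_0 star_diff right_diff_distrib left_diff_distrib)
qed

text \<open>The eigenvector is \<open>p - q\<close>; and \<open>p\<close> is not scalar because \<open>p q = 0\<close> with \<open>p, q \<noteq> 0\<close>.\<close>

lemma bipartite_imp_eigenvector_nonscalar:
  assumes "has_bipartite_component \<psi> A"
  shows "\<exists>x. x \<noteq> 0 \<and> A x = (- d) *\<^sub>C x" and "\<exists>x :: 'b. x \<notin> complex_vector.span {1}"
proof -
  obtain p q where p: "star p = p" "p * p = p" "p \<noteq> 0"
    and q: "star q = q" "q * q = q" "q \<noteq> 0" and pq: "p * q = 0"
    and A_pq: "A p = d *\<^sub>C q" "A q = d *\<^sub>C p"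
    using assms unfolding has_bipartite_component_iff by blast
  have "p \<noteq> q" using p pq by auto
  then show "\<exists>x. x \<noteq> 0 \<and> A x = (- d) *\<^sub>C x"
    by (intro exI[of _ "p - q"]) (simp add: A_simps A_pq complex_vector.scale_right_diff_distrib)
  show "\<exists>x :: 'b. x \<notin> complex_vector.span {1}"
  proof (intro exI notI)
    assume "p \<in> complex_vector.span {1}"
    then obtain a where "p = a *\<^sub>C 1" by (auto simp: complex_vector.span_singleton)
    then show False using pq p(3) q(3) by (auto simp: scaleC_mult_left)
  qed
qed

lemma bipartite_iff:
  "(has_bipartite_component \<psi> A \<longleftrightarrow>
      - d \<in> spectrum A \<and> (d = 0 \<longrightarrow> eigenvalue_mult A 0 \<ge> 2)) \<and>
    (d = 0 \<longrightarrow> (eigenvalue_mult A 0 \<ge> 2 \<longleftrightarrow> complex_vector.dim (UNIV :: 'b set) \<ge> 2))"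
proof (cases "d = 0")
  case True
  then have A0: "A x = 0" for x by (rule degree_0_imp_A_0)
  then have mult: "eigenvalue_mult A 0 = complex_vector.dim (UNIV :: 'b set)"
    by (simp add: eigenvalue_mult_def)
  have "0 \<in> spectrum A"
    unfolding spectrum_iff_eigenvector[OF clinear_A] by (intro exI[of _ 1]) (simp add: A0)
  then show ?thesis
    using True bipartite_imp_eigenvector_nonscalar(2) nonscalar_imp_bipartite[OF True]
    unfolding mult dim_ge_2_iff by auto
next
  case False
  then show ?thesis
    unfolding spectrum_iff_eigenvector[OF clinear_A]
    using bipartite_imp_eigenvector_nonscalar(1) extremal_eigenvector_imp_bipartite[OF False] by auto
qed

end

section \<open>Bipartite components and the spectrum\<close>

lemma regular_tracial_graph_exists:
  fixes \<psi> :: "'a::fd_cstar_algebra \<Rightarrow> complex"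
  assumes graph: "quantum_graph \<psi> A" and und: "undirected \<psi> A" and "tracial \<psi>"
    and reg: "regular_graph \<psi> A d"
  shows "\<exists>E. regular_tracial_graph \<psi> E A d"
proof -
  have A: "clinear A" and \<psi>: "faithful_state \<psi>"
    using graph by (auto simp: quantum_graph_def quantum_set_def)
  interpret state \<psi> by unfold_locales (rule \<psi>)
  obtain S :: "'a set" where S: "finite S" "complex_vector.span S = UNIV" by (rule fd_basis_exists)
  obtain E where E: "finite E"
    "\<And>e e'. e \<in> E \<Longrightarrow> e' \<in> E \<Longrightarrow> L2_inner \<psi> e e' = (if e = e' then 1 else 0)"
    "\<And>x. x \<in> S \<Longrightarrow> x = (\<Sum>e\<in>E. L2_inner \<psi> e x *\<^sub>C e)"
    using orthonormal_set_exists[OF S(1)] by metis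
  have expansion: "x = (\<Sum>e\<in>E. L2_inner \<psi> e x *\<^sub>C e)" if "x \<in> complex_vector.span S" for x
    using that
  proof (induction x rule: complex_vector.span_induct_alt)
    case base
    show ?case by (simp add: L2_inner_def)
  next
    case (step c x y)
    have "c *\<^sub>C x + y = c *\<^sub>C (\<Sum>e\<in>E. L2_inner \<psi> e x *\<^sub>C e) + (\<Sum>e\<in>E. L2_inner \<psi> e y *\<^sub>C e)"
      using E(3)[OF step(1)] step(2) by simp
    also have "\<dots> = (\<Sum>e\<in>E. L2_inner \<psi> e (c *\<^sub>C x + y) *\<^sub>C e)"
      by (simp add: L2_inner_simps scaleC_add_left sum.distrib complex_vector.scale_sum_right
          scaleC_scaleC)
    finally show ?case .
  qed
  interpret traced_algebra \<psi> E
  proof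
    show "\<psi> (x * y) = \<psi> (y * x)" for x y using \<open>tracial \<psi>\<close> by (simp add: tracial_def)
    show "finite E" by (rule E(1))
    show "L2_inner \<psi> e e' = (if e = e' then 1 else 0)" if "e \<in> E" "e' \<in> E" for e e'
      by (rule E(2)[OF that])
    show "(\<Sum>e\<in>E. L2_inner \<psi> e x *\<^sub>C e) = x" for x :: 'a
      using expansion[of x] S(2) by simp
  qed
  have "regular_tracial_graph \<psi> E A d"
  proof (intro regular_tracial_graph.intro regular_tracial_graph_axioms.intro)
    show "traced_algebra \<psi> E" by (rule traced_algebra_axioms)
    show "clinear A" by (rule A)
    show "A (star x) = star (A x)" for x
      using und unfolding undirected_def real_graph_def map_star_def
      by (metis star_star)
    show "L2_inner \<psi> (A x) y = L2_inner \<psi> x (A y)" for x y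
      using L2_adjoint_inner[OF \<psi> A] und by (simp add: undirected_def)
    show "schur \<psi> A A = A" using graph by (simp add: quantum_graph_def)
    show "A 1 = d *\<^sub>C 1" using reg by (simp add: regular_graph_def)
  qed
  then show ?thesis by blast
qed

theorem theorem3p9:
  fixes \<psi> :: "'b::fd_cstar_algebra \<Rightarrow> complex" and A :: "'b \<Rightarrow> 'b" and d :: complex
  assumes "quantum_graph \<psi> A" and "undirected \<psi> A" and "tracial \<psi>" and "regular_graph \<psi> A d"
  shows "(has_bipartite_component \<psi> A \<longleftrightarrow>
      - d \<in> spectrum A \<and> (d = 0 \<longrightarrow> eigenvalue_mult A 0 \<ge> 2)) \<and>
    (d = 0 \<longrightarrow> (eigenvalue_mult A 0 \<ge> 2 \<longleftrightarrow> complex_vector.dim (UNIV :: 'b set) \<ge> 2))"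
proof -
  obtain E where "regular_tracial_graph \<psi> E A d" using regular_tracial_graph_exists[OF assms] by blast
  then interpret regular_tracial_graph \<psi> E A d .
  show ?thesis by (rule bipartite_iff)
qed

end
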